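(* Let $\mathcal A$ be an abelian length category with only finitely many simple objects up to isomorphism. Then $\mathcal A$ is brick-finite if and only if there exists some $N\in\mathbb N$ such that the length of every brick in $\mathcal A$ is less than $N$.
   Context: An abelian length category is an essentially small abelian category in which every object has a finite composition series; the length of an object is its composition length. An object $B$ is a brick if its endomorphism ring is a skew-field; $\mathcal A$ is brick-finite if it has only finitely many isomorphism classes of bricks. *)

theory Defs
  imports "HOL-Algebra.Ring"
begin

section \<open>Categories enriched over abelian groups\<close>

text \<open>
  A category is given by a set of objects and a set of arrows, each arrow carrying its
  domain and codomain. Since the objects and arrows form HOL sets, every such category is
  small; this is how ``essentially small'' is rendered, an essentially small category being
  equivalent to a small one. Operations are constrained only on composable (for \<open>Comp\<close>) or
  parallel (for \<open>Hadd\<close>) arrows inside \<open>Arr\<close>.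
\<close>

record ('o, 'm) precat =
  Obj :: "'o set"
  Arr :: "'m set"
  Dom :: "'m \<Rightarrow> 'o"
  Cod :: "'m \<Rightarrow> 'o"
  Id :: "'o \<Rightarrow> 'm"
  Comp :: "'m \<Rightarrow> 'm \<Rightarrow> 'm" (infixl "\<cdot>\<index>" 70)
    \<comment> \<open>\<open>g \<cdot> f\<close> is \<open>g\<close> after \<open>f\<close>\<close>

record ('o, 'm) preadd_cat = "('o, 'm) precat" +
  Hadd :: "'m \<Rightarrow> 'm \<Rightarrow> 'm" (infixl "\<boxplus>\<index>" 65)
  Hzero :: "'o \<Rightarrow> 'o \<Rightarrow> 'm"

definition Hom :: "('o, 'm, 'z) precat_scheme \<Rightarrow> 'o \<Rightarrow> 'o \<Rightarrow> 'm set" where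
  "Hom C X Y = {f \<in> Arr C. Dom C f = X \<and> Cod C f = Y}"

definition hom_group :: "('o, 'm, 'z) preadd_cat_scheme \<Rightarrow> 'o \<Rightarrow> 'o \<Rightarrow> 'm monoid" where
  "hom_group C X Y = \<lparr>carrier = Hom C X Y, monoid.mult = Hadd C, one = Hzero C X Y\<rparr>"

locale category =
  fixes C (structure)
  assumes Dom_closed: "f \<in> Arr C \<Longrightarrow> Dom C f \<in> Obj C"
    and Cod_closed: "f \<in> Arr C \<Longrightarrow> Cod C f \<in> Obj C"
    and Id_closed: "X \<in> Obj C \<Longrightarrow> Id C X \<in> Hom C X X"
    and Comp_closed: "\<lbrakk>f \<in> Hom C X Y; g \<in> Hom C Y Z\<rbrakk> \<Longrightarrow> g \<cdot> f \<in> Hom C X Z"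
    and Comp_Id_right: "f \<in> Hom C X Y \<Longrightarrow> f \<cdot> Id C X = f"
    and Comp_Id_left: "f \<in> Hom C X Y \<Longrightarrow> Id C Y \<cdot> f = f"
    and Comp_assoc: "\<lbrakk>f \<in> Hom C W X; g \<in> Hom C X Y; h \<in> Hom C Y Z\<rbrakk>
      \<Longrightarrow> (h \<cdot> g) \<cdot> f = h \<cdot> (g \<cdot> f)"

locale preadditive_category = category +
  assumes hom_comm_group: "\<lbrakk>X \<in> Obj C; Y \<in> Obj C\<rbrakk> \<Longrightarrow> comm_group (hom_group C X Y)"
    and Comp_Hadd_right: "\<lbrakk>f \<in> Hom C X Y; f' \<in> Hom C X Y; g \<in> Hom C Y Z\<rbrakk>
      \<Longrightarrow> g \<cdot> (f \<boxplus> f') = g \<cdot> f \<boxplus> g \<cdot> f'"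
    and Comp_Hadd_left: "\<lbrakk>f \<in> Hom C X Y; g \<in> Hom C Y Z; g' \<in> Hom C Y Z\<rbrakk>
      \<Longrightarrow> (g \<boxplus> g') \<cdot> f = g \<cdot> f \<boxplus> g' \<cdot> f"


section \<open>Abelian categories\<close>

definition is_iso :: "('o, 'm, 'z) precat_scheme \<Rightarrow> 'm \<Rightarrow> bool" where
  "is_iso C f \<longleftrightarrow> f \<in> Arr C \<and>
    (\<exists>g \<in> Hom C (Cod C f) (Dom C f).
      Comp C g f = Id C (Dom C f) \<and> Comp C f g = Id C (Cod C f))"

definition iso_rel :: "('o, 'm, 'z) precat_scheme \<Rightarrow> ('o \<times> 'o) set" where
  "iso_rel C = {(X, Y). X \<in> Obj C \<and> Y \<in> Obj C \<and> (\<exists>f \<in> Hom C X Y. is_iso C f)}"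

definition is_mono :: "('o, 'm, 'z) precat_scheme \<Rightarrow> 'm \<Rightarrow> bool" where
  "is_mono C f \<longleftrightarrow> f \<in> Arr C \<and>
    (\<forall>W. \<forall>g \<in> Hom C W (Dom C f). \<forall>h \<in> Hom C W (Dom C f).
      Comp C f g = Comp C f h \<longrightarrow> g = h)"

definition is_epi :: "('o, 'm, 'z) precat_scheme \<Rightarrow> 'm \<Rightarrow> bool" where
  "is_epi C f \<longleftrightarrow> f \<in> Arr C \<and>
    (\<forall>Z. \<forall>g \<in> Hom C (Cod C f) Z. \<forall>h \<in> Hom C (Cod C f) Z.
      Comp C g f = Comp C h f \<longrightarrow> g = h)"

definition is_zero_obj :: "('o, 'm, 'z) precat_scheme \<Rightarrow> 'o \<Rightarrow> bool" where
  "is_zero_obj C X \<longleftrightarrow> X \<in> Obj C \<and>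
    (\<forall>Y \<in> Obj C. (\<exists>!f. f \<in> Hom C X Y) \<and> (\<exists>!f. f \<in> Hom C Y X))"

definition is_kernel :: "('o, 'm, 'z) preadd_cat_scheme \<Rightarrow> 'm \<Rightarrow> 'm \<Rightarrow> bool" where
  "is_kernel C f k \<longleftrightarrow> f \<in> Arr C \<and> k \<in> Arr C \<and> Cod C k = Dom C f \<and>
    Comp C f k = Hzero C (Dom C k) (Cod C f) \<and>
    (\<forall>W. \<forall>h \<in> Hom C W (Dom C f). Comp C f h = Hzero C W (Cod C f) \<longrightarrow>
      (\<exists>!u. u \<in> Hom C W (Dom C k) \<and> Comp C k u = h))"

definition is_cokernel :: "('o, 'm, 'z) preadd_cat_scheme \<Rightarrow> 'm \<Rightarrow> 'm \<Rightarrow> bool" where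
  "is_cokernel C f c \<longleftrightarrow> f \<in> Arr C \<and> c \<in> Arr C \<and> Dom C c = Cod C f \<and>
    Comp C c f = Hzero C (Dom C f) (Cod C c) \<and>
    (\<forall>Z. \<forall>h \<in> Hom C (Cod C f) Z. Comp C h f = Hzero C (Dom C f) Z \<longrightarrow>
      (\<exists>!u. u \<in> Hom C (Cod C c) Z \<and> Comp C u c = h))"

definition is_biproduct ::
  "('o, 'm, 'z) preadd_cat_scheme \<Rightarrow> 'o \<Rightarrow> 'o \<Rightarrow> 'o \<Rightarrow> 'm \<Rightarrow> 'm \<Rightarrow> 'm \<Rightarrow> 'm \<Rightarrow> bool" where
  "is_biproduct C X Y B i j p q \<longleftrightarrow>
    i \<in> Hom C X B \<and> j \<in> Hom C Y B \<and> p \<in> Hom C B X \<and> q \<in> Hom C B Y \<and>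
    Comp C p i = Id C X \<and> Comp C q j = Id C Y \<and>
    Comp C q i = Hzero C X Y \<and> Comp C p j = Hzero C Y X \<and>
    Hadd C (Comp C i p) (Comp C j q) = Id C B"

locale abelian_category = preadditive_category +
  assumes zero_obj_exists: "\<exists>Z. is_zero_obj C Z"
    and biproduct_exists: "\<lbrakk>X \<in> Obj C; Y \<in> Obj C\<rbrakk> \<Longrightarrow> \<exists>B i j p q. is_biproduct C X Y B i j p q"
    and kernel_exists: "f \<in> Arr C \<Longrightarrow> \<exists>k. is_kernel C f k"
    and cokernel_exists: "f \<in> Arr C \<Longrightarrow> \<exists>c. is_cokernel C f c"
    and mono_is_kernel: "is_mono C f \<Longrightarrow> \<exists>g. is_kernel C g f"
    and epi_is_cokernel: "is_epi C f \<Longrightarrow> \<exists>g. is_cokernel C g f"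


section \<open>Composition series and length\<close>

definition simple_obj :: "('o, 'm, 'z) precat_scheme \<Rightarrow> 'o \<Rightarrow> bool" where
  "simple_obj C S \<longleftrightarrow> S \<in> Obj C \<and> \<not> is_zero_obj C S \<and>
    (\<forall>f. is_mono C f \<and> Cod C f = S \<longrightarrow> is_zero_obj C (Dom C f) \<or> is_iso C f)"

text \<open>
  A composition series \<open>0 = X\<^sub>0 \<rightarrow> X\<^sub>1 \<rightarrow> \<dots> \<rightarrow> X\<^sub>n = X\<close>: each \<open>m i\<close> is a monomorphism
  from \<open>Xs i\<close> to \<open>Xs (i + 1)\<close> whose cokernel object is simple. Only \<open>Xs 0, \<dots>, Xs n\<close> and
  \<open>m 0, \<dots>, m (n - 1)\<close> matter.
\<close>

definition composition_series ::
  "('o, 'm, 'z) preadd_cat_scheme \<Rightarrow> 'o \<Rightarrow> nat \<Rightarrow> (nat \<Rightarrow> 'o) \<Rightarrow> (nat \<Rightarrow> 'm) \<Rightarrow> bool" where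
  "composition_series C X n Xs m \<longleftrightarrow>
    is_zero_obj C (Xs 0) \<and> Xs n = X \<and>
    (\<forall>i<n. m i \<in> Hom C (Xs i) (Xs (Suc i)) \<and> is_mono C (m i) \<and>
      (\<exists>c. is_cokernel C (m i) c \<and> simple_obj C (Cod C c)))"

text \<open>Well defined on objects with a composition series, by the Jordan--Hoelder theorem.\<close>

definition obj_length :: "('o, 'm, 'z) preadd_cat_scheme \<Rightarrow> 'o \<Rightarrow> nat" where
  "obj_length C X = (THE n. \<exists>Xs m. composition_series C X n Xs m)"

locale abelian_length_category = abelian_category +
  assumes composition_series_exists:
    "X \<in> Obj C \<Longrightarrow> \<exists>n Xs m. composition_series C X n Xs m"


section \<open>Bricks\<close>

definition skew_field :: "('a, 'z) ring_scheme \<Rightarrow> bool" where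
  "skew_field R \<longleftrightarrow> ring R \<and> \<one>\<^bsub>R\<^esub> \<noteq> \<zero>\<^bsub>R\<^esub> \<and> Units R = carrier R - {\<zero>\<^bsub>R\<^esub>}"

definition End_ring :: "('o, 'm, 'z) preadd_cat_scheme \<Rightarrow> 'o \<Rightarrow> 'm ring" where
  "End_ring C X = \<lparr>carrier = Hom C X X, monoid.mult = Comp C, one = Id C X,
    zero = Hzero C X X, add = Hadd C\<rparr>"

lemma (in preadditive_category) End_ring_is_ring:
  assumes X: "X \<in> Obj C"
  shows "ring (End_ring C X)"
proof -
  interpret G: comm_group "hom_group C X X" using hom_comm_group[OF X X] .
  have "abelian_group (End_ring C X)"
  proof (rule abelian_groupI)
    fix f assume "f \<in> carrier (End_ring C X)"
    then have "f \<in> carrier (hom_group C X X)" by (simp add: End_ring_def hom_group_def)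
    from G.inv_closed[OF this] G.l_inv[OF this]
    show "\<exists>g \<in> carrier (End_ring C X). g \<oplus>\<^bsub>End_ring C X\<^esub> f = \<zero>\<^bsub>End_ring C X\<^esub>"
      by (auto simp: End_ring_def hom_group_def)
  qed (use G.m_closed G.m_assoc G.m_comm G.one_closed G.l_one in
        \<open>auto simp: End_ring_def hom_group_def\<close>)
  moreover have "monoid (End_ring C X)"
    by (rule monoidI)
      (auto simp: End_ring_def Id_closed[OF X] Comp_Id_left Comp_Id_right
        intro: Comp_closed Comp_assoc)
  ultimately show ?thesis
    by (rule ringI)
      (auto simp: End_ring_def intro: Comp_Hadd_left Comp_Hadd_right)
qed

definition brick :: "('o, 'm, 'z) preadd_cat_scheme \<Rightarrow> 'o \<Rightarrow> bool" where
  "brick C B \<longleftrightarrow> B \<in> Obj C \<and> skew_field (End_ring C B)"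

definition finite_up_to_iso :: "('o, 'm, 'z) precat_scheme \<Rightarrow> ('o \<Rightarrow> bool) \<Rightarrow> bool" where
  "finite_up_to_iso C P \<longleftrightarrow> finite ({X \<in> Obj C. P X} // iso_rel C)"

definition brick_finite :: "('o, 'm, 'z) preadd_cat_scheme \<Rightarrow> bool" where
  "brick_finite C \<longleftrightarrow> finite_up_to_iso C (brick C)"

end

theory Submission
  imports Defs
begin

text \<open>
  If there are only finitely many bricks up to isomorphism, their lengths are bounded because
  length is an isomorphism invariant. For the converse, suppose that there are infinitely many
  bricks and that their lengths are bounded; bricks of arbitrarily large length are constructed,
  which is absurd.

  \<^item> Let \<open>r\<close> be minimal such that there are infinitely many bricks of length \<open>r\<close>. Only finitely
    many bricks are shorter, so infinitely many bricks \<open>S\<^sub>0, S\<^sub>1, \<dots>\<close> of length \<open>r\<close> map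
    non-trivially to the same shorter bricks. Every non-zero object \<open>Q\<close> has a brick that is both a
    quotient and a subobject of \<open>Q\<close> (\<open>brick_quotient_subobject\<close>). Applied to an image, this makes
    the \<open>S\<^sub>i\<close> pairwise Hom-orthogonal; applied to a proper non-zero quotient \<open>Q\<close> of some \<open>S\<^sub>i\<close>, it
    shows that every \<open>S\<^sub>j\<close> maps non-trivially to \<open>Q\<close> (\<open>infinitely_many_bricks_orthogonal\<close>).

  \<^item> The objects that map non-trivially to only finitely many \<open>S\<^sub>k\<close> form a torsion class. It
    contains all \<open>S\<^sub>j\<close>, but not every simple object, since there are finitely many simples and each
    \<open>S\<^sub>k\<close> contains one. An object outside the class whose proper quotients all lie in it is called
    critical. Critical objects are bricks, receive no non-zero map from the torsion class, and
    every object outside the class has a critical quotient. As bricks have bounded length, there is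
    a critical \<open>B\<close> of maximal length; then an extension of a torsion object by \<open>B\<close> is again
    torsion unless it splits (\<open>longest_critical_splits\<close>).

  \<^item> Finitely many maps \<open>B \<rightarrow> S\<^sub>k\<close> are jointly monic, for otherwise their common kernel would yield
    a proper quotient of \<open>B\<close> outside the class. In a minimal jointly monic family one may drop
    \<open>S\<^sub>n\<close> to get a non-zero common kernel \<open>K\<close>, which embeds into \<open>S\<^sub>n\<close>. The quotient \<open>S\<^sub>n / K\<close> receives
    a non-zero map from some \<open>S\<^sub>j\<close> outside the family, and pulling back along it and pushing out
    along \<open>K \<rightarrow> B\<close> gives a non-split extension \<open>0 \<rightarrow> B \<rightarrow> X \<rightarrow> S\<^sub>j \<rightarrow> 0\<close>
    (\<open>critical_nonsplit_extension\<close>).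

  \<^item> Hence \<open>X\<close> is torsion, so for infinitely many \<open>k\<close> some non-zero map \<open>B \<rightarrow> S\<^sub>k\<close> does not extend to
    \<open>X\<close>, and pushing out along it gives a non-split extension of \<open>S\<^sub>j\<close> by \<open>S\<^sub>k\<close>. Amalgamating \<open>m\<close>
    of these over \<open>S\<^sub>j\<close> produces a brick of length greater than \<open>m\<close> (\<open>long_bricks\<close>).
\<close>

section \<open>Monomorphisms, epimorphisms and isomorphisms\<close>

context category begin

lemma Hom_Obj: "f \<in> Hom C X Y \<Longrightarrow> X \<in> Obj C \<and> Y \<in> Obj C"
  using Dom_closed Cod_closed by (auto simp: Hom_def)

lemma comp_eq_extend:
  assumes "g \<cdot> f = k" "f \<in> Hom C X Y" "g \<in> Hom C Y Z" "x \<in> Hom C W X"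
  shows "g \<cdot> (f \<cdot> x) = k \<cdot> x"
  using Comp_assoc[OF assms(4,2,3)] assms(1) by simp

lemma monoD:
  assumes "is_mono C f" "f \<in> Hom C X Y" "g \<in> Hom C W X" "h \<in> Hom C W X" "f \<cdot> g = f \<cdot> h"
  shows "g = h"
  using assms unfolding is_mono_def Hom_def by blast

lemma epiD:
  assumes "is_epi C f" "f \<in> Hom C X Y" "g \<in> Hom C Y Z" "h \<in> Hom C Y Z" "g \<cdot> f = h \<cdot> f"
  shows "g = h"
  using assms unfolding is_epi_def Hom_def by blast

lemma monoI:
  assumes "f \<in> Hom C X Y"
    and "\<And>W g h. g \<in> Hom C W X \<Longrightarrow> h \<in> Hom C W X \<Longrightarrow> f \<cdot> g = f \<cdot> h \<Longrightarrow> g = h"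
  shows "is_mono C f"
  using assms unfolding is_mono_def by (auto simp: Hom_def)

lemma epiI:
  assumes "f \<in> Hom C X Y"
    and "\<And>Z g h. g \<in> Hom C Y Z \<Longrightarrow> h \<in> Hom C Y Z \<Longrightarrow> g \<cdot> f = h \<cdot> f \<Longrightarrow> g = h"
  shows "is_epi C f"
  using assms unfolding is_epi_def by (auto simp: Hom_def)

lemma mono_comp:
  assumes "is_mono C f" "is_mono C g" "f \<in> Hom C X Y" "g \<in> Hom C Y Z"
  shows "is_mono C (g \<cdot> f)"
proof (rule monoI)
  show "g \<cdot> f \<in> Hom C X Z" using assms Comp_closed by blast
  fix W x y assume xy: "x \<in> Hom C W X" "y \<in> Hom C W X" "(g \<cdot> f) \<cdot> x = (g \<cdot> f) \<cdot> y"
  then have "g \<cdot> (f \<cdot> x) = g \<cdot> (f \<cdot> y)"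
    using Comp_assoc[OF _ assms(3,4)] by simp
  then have "f \<cdot> x = f \<cdot> y" using monoD[OF assms(2,4)] Comp_closed xy assms(3) by blast
  then show "x = y" using monoD[OF assms(1,3)] xy by blast
qed

lemma epi_comp:
  assumes "is_epi C f" "is_epi C g" "f \<in> Hom C X Y" "g \<in> Hom C Y Z"
  shows "is_epi C (g \<cdot> f)"
proof (rule epiI)
  show "g \<cdot> f \<in> Hom C X Z" using assms Comp_closed by blast
  fix V x y assume x: "x \<in> Hom C Z V" and y: "y \<in> Hom C Z V" and eq: "x \<cdot> (g \<cdot> f) = y \<cdot> (g \<cdot> f)"
  have "(x \<cdot> g) \<cdot> f = (y \<cdot> g) \<cdot> f" using eq Comp_assoc assms x y by metis
  then have "x \<cdot> g = y \<cdot> g" using epiD[OF assms(1,3)] Comp_closed assms(4) x y by blast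
  then show "x = y" using epiD[OF assms(2,4)] x y by blast
qed

lemma mono_cancel:
  assumes f: "f \<in> Hom C X Y" and g: "g \<in> Hom C Y Z" and m: "is_mono C (g \<cdot> f)"
  shows "is_mono C f"
proof (rule monoI[OF f])
  fix W x y assume xy: "x \<in> Hom C W X" "y \<in> Hom C W X" "f \<cdot> x = f \<cdot> y"
  then have "(g \<cdot> f) \<cdot> x = (g \<cdot> f) \<cdot> y"
    using Comp_assoc[OF xy(1) f g] Comp_assoc[OF xy(2) f g] by simp
  then show "x = y" using monoD[OF m Comp_closed[OF f g] xy(1,2)] by blast
qed

lemma epi_cancel:
  assumes f: "f \<in> Hom C X Y" and g: "g \<in> Hom C Y Z" and e: "is_epi C (g \<cdot> f)"
  shows "is_epi C g"
proof (rule epiI[OF g])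
  fix V x y assume xy: "x \<in> Hom C Z V" "y \<in> Hom C Z V" "x \<cdot> g = y \<cdot> g"
  then have "x \<cdot> (g \<cdot> f) = y \<cdot> (g \<cdot> f)"
    using Comp_assoc[OF f g xy(1)] Comp_assoc[OF f g xy(2)] by simp
  then show "x = y" using epiD[OF e Comp_closed[OF f g] xy(1,2)] by blast
qed

lemma isoE:
  assumes "is_iso C f" "f \<in> Hom C X Y"
  obtains g where "g \<in> Hom C Y X" "g \<cdot> f = Id C X" "f \<cdot> g = Id C Y"
  using assms unfolding is_iso_def Hom_def by auto

lemma isoI:
  assumes "f \<in> Hom C X Y" "g \<in> Hom C Y X" "g \<cdot> f = Id C X" "f \<cdot> g = Id C Y"
  shows "is_iso C f"
  using assms unfolding is_iso_def Hom_def by auto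

lemma Id_iso: "X \<in> Obj C \<Longrightarrow> is_iso C (Id C X)"
  using isoI[of "Id C X" X X "Id C X"] Id_closed Comp_Id_left by blast

lemma iso_mono:
  assumes "is_iso C f" shows "is_mono C f"
proof -
  let ?X = "Dom C f" and ?Y = "Cod C f"
  have f: "f \<in> Hom C ?X ?Y" using assms by (auto simp: is_iso_def Hom_def)
  then obtain g where g: "g \<in> Hom C ?Y ?X" "g \<cdot> f = Id C ?X" using assms isoE by metis
  show ?thesis
  proof (rule monoI[OF f])
    fix W x y assume xy: "x \<in> Hom C W ?X" "y \<in> Hom C W ?X" "f \<cdot> x = f \<cdot> y"
    have "x = g \<cdot> (f \<cdot> x)" using Comp_assoc[OF xy(1) f g(1)] Comp_Id_left[OF xy(1)] g(2) by simp
    also have "\<dots> = g \<cdot> (f \<cdot> y)" by (simp only: xy(3))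
    also have "\<dots> = y" using Comp_assoc[OF xy(2) f g(1)] Comp_Id_left[OF xy(2)] g(2) by simp
    finally show "x = y" .
  qed
qed

lemma iso_epi:
  assumes "is_iso C f" shows "is_epi C f"
proof -
  let ?X = "Dom C f" and ?Y = "Cod C f"
  have f: "f \<in> Hom C ?X ?Y" using assms by (auto simp: is_iso_def Hom_def)
  then obtain g where g: "g \<in> Hom C ?Y ?X" "f \<cdot> g = Id C ?Y" using assms isoE by metis
  show ?thesis
  proof (rule epiI[OF f])
    fix Z x y assume xy: "x \<in> Hom C ?Y Z" "y \<in> Hom C ?Y Z" "x \<cdot> f = y \<cdot> f"
    have "x = (x \<cdot> f) \<cdot> g" using Comp_assoc[OF g(1) f xy(1)] Comp_Id_right[OF xy(1)] g(2) by simp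
    also have "\<dots> = (y \<cdot> f) \<cdot> g" by (simp only: xy(3))
    also have "\<dots> = y" using Comp_assoc[OF g(1) f xy(2)] Comp_Id_right[OF xy(2)] g(2) by simp
    finally show "x = y" .
  qed
qed

lemma iso_comp:
  assumes "is_iso C f" "is_iso C g" "f \<in> Hom C X Y" "g \<in> Hom C Y Z"
  shows "is_iso C (g \<cdot> f)"
proof -
  obtain f' where f': "f' \<in> Hom C Y X" "f' \<cdot> f = Id C X" "f \<cdot> f' = Id C Y" using assms isoE by metis
  obtain g' where g': "g' \<in> Hom C Z Y" "g' \<cdot> g = Id C Y" "g \<cdot> g' = Id C Z" using assms isoE by metis
  show ?thesis
  proof (rule isoI)
    show "g \<cdot> f \<in> Hom C X Z" "f' \<cdot> g' \<in> Hom C Z X" using assms f' g' Comp_closed by blast+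
    show "(f' \<cdot> g') \<cdot> (g \<cdot> f) = Id C X"
      using Comp_assoc[OF Comp_closed[OF assms(3,4)] g'(1) f'(1)]
        comp_eq_extend[OF g'(2) assms(4) g'(1) assms(3)] Comp_Id_left[OF assms(3)] f'(2) by simp
    show "(g \<cdot> f) \<cdot> (f' \<cdot> g') = Id C Z"
      using Comp_assoc[OF Comp_closed[OF g'(1) f'(1)] assms(3,4)]
        comp_eq_extend[OF f'(3) f'(1) assms(3) g'(1)] Comp_Id_left[OF g'(1)] g'(3) by simp
  qed
qed

lemma iso_rel_equiv: "equiv (Obj C) (iso_rel C)"
proof (rule equivI)
  show "iso_rel C \<subseteq> Obj C \<times> Obj C" by (auto simp: iso_rel_def)
  show "refl_on (Obj C) (iso_rel C)"
    by (rule refl_onI) (use Id_iso Id_closed in \<open>auto simp: iso_rel_def\<close>)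
  show "sym (iso_rel C)"
  proof (rule symI)
    fix X Y assume "(X, Y) \<in> iso_rel C"
    then obtain f where f: "X \<in> Obj C" "Y \<in> Obj C" "f \<in> Hom C X Y" "is_iso C f"
      by (auto simp: iso_rel_def)
    then obtain g where "g \<in> Hom C Y X" "g \<cdot> f = Id C X" "f \<cdot> g = Id C Y" using isoE by metis
    then show "(Y, X) \<in> iso_rel C" using f isoI[of g Y X f] by (auto simp: iso_rel_def)
  qed
  show "trans (iso_rel C)"
    by (rule transI) (auto simp: iso_rel_def intro: iso_comp Comp_closed)
qed

end

section \<open>Zero morphisms, differences and kernels\<close>

context preadditive_category begin

lemma zero_closed:
  assumes "X \<in> Obj C" "Y \<in> Obj C" shows "Hzero C X Y \<in> Hom C X Y"
proof -
  interpret comm_group "hom_group C X Y" using hom_comm_group assms .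
  show ?thesis using one_closed by (simp add: hom_group_def)
qed

lemma add_closed:
  assumes "f \<in> Hom C X Y" "g \<in> Hom C X Y" shows "f \<boxplus> g \<in> Hom C X Y"
proof -
  interpret comm_group "hom_group C X Y" using hom_comm_group Hom_Obj assms by blast
  show ?thesis using m_closed assms by (simp add: hom_group_def)
qed

lemma add_self_zero:
  assumes "f \<in> Hom C X Y" "f \<boxplus> f = f" shows "f = Hzero C X Y"
proof -
  interpret comm_group "hom_group C X Y" using hom_comm_group Hom_Obj assms by blast
  show ?thesis using assms r_cancel_one[of f f] by (simp add: hom_group_def)
qed

lemma add_zero:
  assumes "f \<in> Hom C X Y"
  shows "f \<boxplus> Hzero C X Y = f" "Hzero C X Y \<boxplus> f = f"
proof -
  interpret comm_group "hom_group C X Y" using hom_comm_group Hom_Obj assms by blast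
  show "f \<boxplus> Hzero C X Y = f" "Hzero C X Y \<boxplus> f = f"
    using assms r_one l_one by (auto simp: hom_group_def)
qed

lemma comp_zero_right:
  assumes "g \<in> Hom C Y Z" "X \<in> Obj C" shows "g \<cdot> Hzero C X Y = Hzero C X Z"
proof (rule add_self_zero)
  have Y: "Y \<in> Obj C" using Hom_Obj assms by blast
  have z: "Hzero C X Y \<in> Hom C X Y" using Y assms zero_closed by blast
  show "g \<cdot> Hzero C X Y \<in> Hom C X Z" using z assms Comp_closed by blast
  show "g \<cdot> Hzero C X Y \<boxplus> g \<cdot> Hzero C X Y = g \<cdot> Hzero C X Y"
    using Comp_Hadd_right[OF z z assms(1)] add_zero[OF z] by simp
qed

lemma comp_zero_left:
  assumes "f \<in> Hom C X Y" "Z \<in> Obj C" shows "Hzero C Y Z \<cdot> f = Hzero C X Z"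
proof (rule add_self_zero)
  have Y: "Y \<in> Obj C" using Hom_Obj assms by blast
  have z: "Hzero C Y Z \<in> Hom C Y Z" using Y assms zero_closed by blast
  show "Hzero C Y Z \<cdot> f \<in> Hom C X Z" using z assms Comp_closed by blast
  show "Hzero C Y Z \<cdot> f \<boxplus> Hzero C Y Z \<cdot> f = Hzero C Y Z \<cdot> f"
    using Comp_Hadd_left[OF assms(1) z z] add_zero[OF z] by simp
qed

text \<open>
  The inverse is taken in the group of the first argument, so this is subtraction for parallel
  morphisms only.
\<close>
definition diff where
  "diff f g = f \<boxplus> m_inv (hom_group C (Dom C f) (Cod C f)) g"

lemma
  assumes f: "f \<in> Hom C X Y" and g: "g \<in> Hom C X Y"
  shows diff_closed: "diff f g \<in> Hom C X Y"
    and diff_eq_zero: "diff f g = Hzero C X Y \<longleftrightarrow> f = g"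
    and diff_add: "diff f g \<boxplus> g = f"
proof -
  interpret comm_group "hom_group C X Y" using hom_comm_group Hom_Obj assms by blast
  have d: "diff f g = f \<otimes>\<^bsub>hom_group C X Y\<^esub> inv\<^bsub>hom_group C X Y\<^esub> g"
    using f by (auto simp: diff_def hom_group_def Hom_def)
  have c: "f \<in> carrier (hom_group C X Y)" "g \<in> carrier (hom_group C X Y)"
    using f g by (auto simp: hom_group_def)
  show "diff f g \<in> Hom C X Y" unfolding d using c m_closed inv_closed
    by (simp add: hom_group_def)
  have "f \<otimes>\<^bsub>hom_group C X Y\<^esub> inv\<^bsub>hom_group C X Y\<^esub> g \<otimes>\<^bsub>hom_group C X Y\<^esub> g = f"
    using c by (simp add: m_assoc)
  then show "diff f g \<boxplus> g = f" unfolding d by (simp add: hom_group_def)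
  have "f \<otimes>\<^bsub>hom_group C X Y\<^esub> inv\<^bsub>hom_group C X Y\<^esub> g = \<one>\<^bsub>hom_group C X Y\<^esub> \<longleftrightarrow> f = g"
    using c by (metis inv_closed inv_inv inv_equality r_inv)
  then show "diff f g = Hzero C X Y \<longleftrightarrow> f = g" unfolding d by (simp add: hom_group_def)
qed

lemma diff_unique:
  assumes "f \<in> Hom C X Y" "g \<in> Hom C X Y" "h \<in> Hom C X Y" "h \<boxplus> g = f"
  shows "h = diff f g"
proof -
  interpret comm_group "hom_group C X Y" using hom_comm_group Hom_Obj assms by blast
  have "h \<boxplus> g = diff f g \<boxplus> g" using assms diff_add by simp
  then show ?thesis
    using right_cancel[of g h "diff f g"] assms diff_closed[OF assms(1,2)]
    by (simp add: hom_group_def)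
qed

lemma comp_diff_right:
  assumes f: "f \<in> Hom C X Y" and g: "g \<in> Hom C X Y" and h: "h \<in> Hom C Y Z"
  shows "h \<cdot> diff f g = diff (h \<cdot> f) (h \<cdot> g)"
proof (rule diff_unique)
  show "h \<cdot> f \<in> Hom C X Z" "h \<cdot> g \<in> Hom C X Z" "h \<cdot> diff f g \<in> Hom C X Z"
    using Comp_closed[OF _ h] diff_closed f g by blast+
  show "h \<cdot> diff f g \<boxplus> h \<cdot> g = h \<cdot> f"
    using Comp_Hadd_right[OF diff_closed[OF f g] g h] diff_add[OF f g] by simp
qed

lemma comp_diff_left:
  assumes f: "f \<in> Hom C Y Z" and g: "g \<in> Hom C Y Z" and h: "h \<in> Hom C X Y"
  shows "diff f g \<cdot> h = diff (f \<cdot> h) (g \<cdot> h)"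
proof (rule diff_unique)
  show "f \<cdot> h \<in> Hom C X Z" "g \<cdot> h \<in> Hom C X Z" "diff f g \<cdot> h \<in> Hom C X Z"
    using Comp_closed[OF h] diff_closed f g by blast+
  show "diff f g \<cdot> h \<boxplus> g \<cdot> h = f \<cdot> h"
    using Comp_Hadd_left[OF h diff_closed[OF f g] g] diff_add[OF f g] by simp
qed

lemma diff_zero:
  assumes "f \<in> Hom C X Y" shows "diff f (Hzero C X Y) = f"
  using diff_unique[of f X Y "Hzero C X Y" f] assms add_zero Hom_Obj zero_closed by metis

lemma mono_zeroI:
  assumes f: "f \<in> Hom C X Y"
    and z: "\<And>W g. g \<in> Hom C W X \<Longrightarrow> f \<cdot> g = Hzero C W Y \<Longrightarrow> g = Hzero C W X"
  shows "is_mono C f"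
proof (rule monoI[OF f])
  fix W g h assume gh: "g \<in> Hom C W X" "h \<in> Hom C W X" "f \<cdot> g = f \<cdot> h"
  then have "f \<cdot> diff g h = Hzero C W Y"
    using comp_diff_right[OF gh(1,2) f] diff_eq_zero Comp_closed f by metis
  then show "g = h" using z diff_closed diff_eq_zero gh by metis
qed

lemma epi_zeroI:
  assumes f: "f \<in> Hom C X Y"
    and z: "\<And>Z g. g \<in> Hom C Y Z \<Longrightarrow> g \<cdot> f = Hzero C X Z \<Longrightarrow> g = Hzero C Y Z"
  shows "is_epi C f"
proof (rule epiI[OF f])
  fix Z g h assume gh: "g \<in> Hom C Y Z" "h \<in> Hom C Y Z" and e: "g \<cdot> f = h \<cdot> f"
  then have "diff g h \<cdot> f = Hzero C X Z"
    using comp_diff_left[OF gh f] e diff_eq_zero Comp_closed f by metis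
  then show "g = h" using z diff_closed diff_eq_zero gh by metis
qed

lemma mono_zeroD:
  assumes "is_mono C f" "f \<in> Hom C X Y" "g \<in> Hom C W X" "f \<cdot> g = Hzero C W Y"
  shows "g = Hzero C W X"
  using monoD[OF assms(1-3), of "Hzero C W X"] assms comp_zero_right Hom_Obj zero_closed by metis

lemma epi_zeroD:
  assumes "is_epi C f" "f \<in> Hom C X Y" "g \<in> Hom C Y Z" "g \<cdot> f = Hzero C X Z"
  shows "g = Hzero C Y Z"
  using epiD[OF assms(1-3), of "Hzero C Y Z"] assms comp_zero_left Hom_Obj zero_closed by metis

lemma zero_obj_iff:
  "is_zero_obj C X \<longleftrightarrow> X \<in> Obj C \<and> Id C X = Hzero C X X"
proof
  assume "is_zero_obj C X"
  then show "X \<in> Obj C \<and> Id C X = Hzero C X X"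
    unfolding is_zero_obj_def using Id_closed zero_closed by blast
next
  assume X: "X \<in> Obj C \<and> Id C X = Hzero C X X"
  have "f = Hzero C X Y" if "f \<in> Hom C X Y" for f Y
    using that X Comp_Id_right comp_zero_right Hom_Obj by metis
  moreover have "f = Hzero C Y X" if "f \<in> Hom C Y X" for f Y
    using that X Comp_Id_left comp_zero_left Hom_Obj by metis
  ultimately show "is_zero_obj C X"
    unfolding is_zero_obj_def using X zero_closed by blast
qed

lemma zero_obj_hom:
  assumes "is_zero_obj C X"
  shows "f \<in> Hom C X Y \<Longrightarrow> f = Hzero C X Y" "f \<in> Hom C Y X \<Longrightarrow> f = Hzero C Y X"
  using assms unfolding is_zero_obj_def using Hom_Obj zero_closed by (metis)+

lemma kernel_hom:
  assumes "is_kernel C f k" "f \<in> Hom C X Y"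
  shows "k \<in> Hom C (Dom C k) X"
  using assms by (auto simp: is_kernel_def Hom_def)

lemma kernel_comp:
  assumes "is_kernel C f k" "f \<in> Hom C X Y" "k \<in> Hom C K X"
  shows "f \<cdot> k = Hzero C K Y"
  using assms by (auto simp: is_kernel_def Hom_def)

lemma kernel_lift:
  assumes "is_kernel C f k" "f \<in> Hom C X Y" "k \<in> Hom C K X" "h \<in> Hom C W X" "f \<cdot> h = Hzero C W Y"
  obtains u where "u \<in> Hom C W K" "k \<cdot> u = h"
  using assms unfolding is_kernel_def Hom_def by blast

lemma kernel_mono:
  assumes "is_kernel C f k" shows "is_mono C k"
proof -
  define X Y K where "X = Dom C f" "Y = Cod C f" "K = Dom C k"
  have f: "f \<in> Hom C X Y" and k: "k \<in> Hom C K X"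
    using assms by (auto simp: is_kernel_def Hom_def X_Y_K_def)
  show ?thesis
  proof (rule monoI[OF k])
    fix W g h assume gh: "g \<in> Hom C W K" "h \<in> Hom C W K" "k \<cdot> g = k \<cdot> h"
    have "f \<cdot> (k \<cdot> g) = Hzero C W Y"
      using comp_eq_extend[OF kernel_comp[OF assms f k] k f gh(1)] comp_zero_left[OF gh(1)]
        Hom_Obj f by simp
    moreover have "k \<cdot> g \<in> Hom C W X" using k gh Comp_closed by blast
    moreover have "\<exists>!u. u \<in> Hom C W K \<and> k \<cdot> u = h'" if "h' \<in> Hom C W X" "f \<cdot> h' = Hzero C W Y" for h'
      using assms that unfolding is_kernel_def X_Y_K_def by auto
    ultimately have "\<exists>!u. u \<in> Hom C W K \<and> k \<cdot> u = k \<cdot> g" by blast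
    then show "g = h" using gh by metis
  qed
qed

lemma kernelI:
  assumes "f \<in> Hom C X Y" "is_mono C k" "k \<in> Hom C K X" "f \<cdot> k = Hzero C K Y"
    and "\<And>W h. h \<in> Hom C W X \<Longrightarrow> f \<cdot> h = Hzero C W Y \<Longrightarrow> \<exists>u \<in> Hom C W K. k \<cdot> u = h"
  shows "is_kernel C f k"
proof -
  have d: "Dom C f = X" "Cod C f = Y" "Dom C k = K" "Cod C k = X" "f \<in> Arr C" "k \<in> Arr C"
    using assms by (auto simp: Hom_def)
  have "\<exists>!u. u \<in> Hom C W K \<and> k \<cdot> u = h" if "h \<in> Hom C W X" "f \<cdot> h = Hzero C W Y" for W h
    using assms(5)[OF that] monoD[OF assms(2,3)] by blast
  then show ?thesis unfolding is_kernel_def d using d assms(4) by simp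
qed

end

section \<open>The opposite category\<close>

text \<open>
  Cokernels and pushouts are the kernels and pullbacks of the opposite category, which is again
  abelian; so their properties can be read off from the dual ones.
\<close>
definition op_cat :: "('o, 'm, 'z) preadd_cat_scheme \<Rightarrow> ('o, 'm) preadd_cat" where
  "op_cat C = \<lparr>Obj = Obj C, Arr = Arr C, Dom = Cod C, Cod = Dom C, Id = Id C,
    Comp = (\<lambda>g f. Comp C f g), Hadd = Hadd C, Hzero = (\<lambda>X Y. Hzero C Y X)\<rparr>"

lemma op_cat_simps [simp]:
  "Obj (op_cat C) = Obj C" "Arr (op_cat C) = Arr C" "Dom (op_cat C) = Cod C"
  "Cod (op_cat C) = Dom C" "Id (op_cat C) = Id C" "Comp (op_cat C) g f = Comp C f g"
  "Hadd (op_cat C) = Hadd C" "Hzero (op_cat C) X Y = Hzero C Y X"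
  by (simp_all add: op_cat_def)

lemma op_cat_notions [simp]:
  "Hom (op_cat C) X Y = Hom C Y X"
  "is_mono (op_cat C) f = is_epi C f"
  "is_epi (op_cat C) f = is_mono C f"
  "is_kernel (op_cat C) f k = is_cokernel C f k"
  "is_cokernel (op_cat C) f k = is_kernel C f k"
proof -
  show H: "Hom (op_cat C) X Y = Hom C Y X" for X Y by (auto simp: Hom_def)
  show "is_mono (op_cat C) f = is_epi C f" "is_epi (op_cat C) f = is_mono C f"
    by (simp_all add: is_mono_def is_epi_def H)
  show "is_kernel (op_cat C) f k = is_cokernel C f k" "is_cokernel (op_cat C) f k = is_kernel C f k"
    by (auto simp add: is_kernel_def is_cokernel_def H)
qed

lemma op_cat_biproduct:
  "is_biproduct C X Y B i j p q \<Longrightarrow> is_biproduct (op_cat C) X Y B p q i j"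
  by (simp add: is_biproduct_def)

lemma op_cat_category:
  assumes "category C" shows "category (op_cat C)"
proof -
  interpret category C by fact
  show ?thesis
    by unfold_locales
      (simp_all add: Dom_closed Cod_closed Id_closed Comp_closed Comp_Id_left Comp_Id_right Comp_assoc)
qed

lemma op_cat_preadditive:
  assumes "preadditive_category C" shows "preadditive_category (op_cat C)"
proof -
  interpret preadditive_category C by fact
  have "hom_group (op_cat C) X Y = hom_group C Y X" for X Y
    by (simp add: hom_group_def)
  then show ?thesis
    unfolding preadditive_category_def preadditive_category_axioms_def
    using op_cat_category[OF category_axioms] hom_comm_group Comp_Hadd_right Comp_Hadd_left
    by simp
qed

lemma op_cat_abelian:
  assumes "abelian_category C" shows "abelian_category (op_cat C)"
proof -
  interpret abelian_category C by fact
  have "\<exists>Z. is_zero_obj (op_cat C) Z"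
    using zero_obj_exists by (simp add: is_zero_obj_def) metis
  moreover have "\<exists>B i j p q. is_biproduct (op_cat C) X Y B i j p q"
    if XY: "X \<in> Obj C" "Y \<in> Obj C" for X Y
  proof -
    obtain B i j p q where "is_biproduct C X Y B i j p q" using biproduct_exists[OF XY] by blast
    then have "is_biproduct (op_cat C) X Y B p q i j" by (rule op_cat_biproduct)
    then show ?thesis by blast
  qed
  ultimately show ?thesis
    unfolding abelian_category_def abelian_category_axioms_def
    using op_cat_preadditive[OF preadditive_category_axioms] kernel_exists cokernel_exists
      mono_is_kernel epi_is_cokernel by simp
qed

context preadditive_category begin

lemma cokernel_hom:
  assumes "is_cokernel C f c" "f \<in> Hom C X Y" shows "c \<in> Hom C Y (Cod C c)"
proof -
  interpret op: preadditive_category "op_cat C" by (rule op_cat_preadditive) unfold_locales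
  show ?thesis using op.kernel_hom[of f c Y X] assms by simp
qed

lemma cokernel_comp:
  assumes "is_cokernel C f c" "f \<in> Hom C X Y" "c \<in> Hom C Y Q" shows "c \<cdot> f = Hzero C X Q"
proof -
  interpret op: preadditive_category "op_cat C" by (rule op_cat_preadditive) unfold_locales
  show ?thesis using op.kernel_comp[of f c Y X Q] assms by simp
qed

lemma cokernel_factor:
  assumes "is_cokernel C f c" "f \<in> Hom C X Y" "c \<in> Hom C Y Q" "h \<in> Hom C Y Z"
    "h \<cdot> f = Hzero C X Z"
  obtains u where "u \<in> Hom C Q Z" "u \<cdot> c = h"
proof -
  interpret op: preadditive_category "op_cat C" by (rule op_cat_preadditive) unfold_locales
  show ?thesis by (rule op.kernel_lift[of f c Y X Q h Z]) (use assms that in simp_all)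
qed

lemma cokernel_epi:
  assumes "is_cokernel C f c" shows "is_epi C c"
proof -
  interpret op: preadditive_category "op_cat C" by (rule op_cat_preadditive) unfold_locales
  show ?thesis using op.kernel_mono[of f c] assms by simp
qed

end

section \<open>Short exact sequences\<close>

context abelian_category begin

lemma kernel_obtain:
  assumes "f \<in> Hom C X Y"
  obtains K k where "k \<in> Hom C K X" "is_kernel C f k" "is_mono C k"
proof -
  obtain k where "is_kernel C f k" using kernel_exists[of f] assms by (auto simp: Hom_def)
  then show ?thesis using that kernel_hom[of f k X Y] kernel_mono assms by blast
qed

lemma cokernel_obtain:
  assumes "f \<in> Hom C X Y"
  obtains Q c where "c \<in> Hom C Y Q" "is_cokernel C f c" "is_epi C c"
proof -
  obtain c where "is_cokernel C f c" using cokernel_exists[of f] assms by (auto simp: Hom_def)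
  then show ?thesis using that cokernel_hom[of f c X Y] cokernel_epi assms by blast
qed

text \<open>
  A monomorphism \<open>i\<close> is the kernel of some \<open>g\<close>; since \<open>g\<close> factors through the cokernel \<open>c\<close> of \<open>i\<close>,
  whatever \<open>c\<close> kills is killed by \<open>g\<close> and hence factors through \<open>i\<close>.
\<close>
lemma mono_kernel_of_cokernel:
  assumes i: "is_mono C i" "i \<in> Hom C K X" and c: "is_cokernel C i c"
  shows "is_kernel C c i"
proof -
  obtain g where g: "is_kernel C g i" using mono_is_kernel i by blast
  then obtain Y where gh: "g \<in> Hom C X Y" using i by (auto simp: is_kernel_def Hom_def)
  obtain Q where ch: "c \<in> Hom C X Q" using cokernel_hom[OF c i(2)] by blast
  have "g \<cdot> i = Hzero C K Y" using kernel_comp[OF g gh i(2)] .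
  then obtain g' where g': "g' \<in> Hom C Q Y" "g' \<cdot> c = g"
    using cokernel_factor[OF c i(2) ch gh] by blast
  show ?thesis
  proof (rule kernelI[OF ch i(1,2) cokernel_comp[OF c i(2) ch]])
    fix W h assume h: "h \<in> Hom C W X" "c \<cdot> h = Hzero C W Q"
    have "g \<cdot> h = g' \<cdot> (c \<cdot> h)" using Comp_assoc[OF h(1) ch g'(1)] g'(2) by simp
    also have "\<dots> = Hzero C W Y" using comp_zero_right[OF g'(1)] Hom_Obj h by metis
    finally show "\<exists>u\<in>Hom C W K. i \<cdot> u = h" using kernel_lift[OF g gh i(2) h(1)] by blast
  qed
qed

lemma epi_cokernel_of_kernel:
  assumes "is_epi C p" "p \<in> Hom C X Q" "is_kernel C p k"
  shows "is_cokernel C k p"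
proof -
  interpret op: abelian_category "op_cat C" by (rule op_cat_abelian) unfold_locales
  show ?thesis using op.mono_kernel_of_cokernel[of p Q X k] assms by simp
qed

text \<open>
  As a monomorphism, \<open>f\<close> is the kernel of some \<open>g\<close>, and \<open>g = 0\<close> because \<open>f\<close> is epi. So the
  identity factors through \<open>f\<close>, which gives an inverse.
\<close>
lemma mono_epi_iso:
  assumes "is_mono C f" "is_epi C f" shows "is_iso C f"
proof -
  obtain X Y where f: "f \<in> Hom C X Y" using assms by (auto simp: is_mono_def Hom_def)
  obtain g where g: "is_kernel C g f" using mono_is_kernel assms by blast
  then obtain Z where gh: "g \<in> Hom C Y Z" using f by (auto simp: is_kernel_def Hom_def)
  have o: "X \<in> Obj C" "Y \<in> Obj C" "Z \<in> Obj C" using Hom_Obj f gh by auto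
  have g0: "g = Hzero C Y Z" using epi_zeroD[OF assms(2) f gh] kernel_comp[OF g gh f] by simp
  have "g \<cdot> Id C Y = Hzero C Y Z" using Comp_Id_right gh g0 by simp
  then obtain u where u: "u \<in> Hom C Y X" "f \<cdot> u = Id C Y"
    using kernel_lift[OF g gh f Id_closed[OF o(2)]] by blast
  have "f \<cdot> (u \<cdot> f) = f \<cdot> Id C X"
    using Comp_assoc[OF f u(1) f] u(2) Comp_Id_left[OF f] Comp_Id_right[OF f] by simp
  then have "u \<cdot> f = Id C X"
    using monoD[OF assms(1) f Comp_closed[OF f u(1)] Id_closed[OF o(1)]] by simp
  then show ?thesis using isoI[OF f u(1)] u(2) by simp
qed

text \<open>
  The image is the kernel of the cokernel. What needs an argument is that the corestriction to it
  is an epimorphism.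
\<close>
lemma image_factorization:
  assumes f: "f \<in> Hom C X Y"
  obtains I e m where "e \<in> Hom C X I" "m \<in> Hom C I Y" "is_epi C e" "is_mono C m" "f = m \<cdot> e"
proof -
  obtain Q c where c: "c \<in> Hom C Y Q" "is_cokernel C f c" using cokernel_obtain[OF f] .
  obtain I m where m: "m \<in> Hom C I Y" "is_kernel C c m" "is_mono C m" using kernel_obtain[OF c(1)] .
  obtain e where e: "e \<in> Hom C X I" "m \<cdot> e = f"
    using kernel_lift[OF m(2) c(1) m(1) f] cokernel_comp[OF c(2) f c(1)] by blast
  have "is_epi C e"
  proof (rule epi_zeroI[OF e(1)])
    fix V x assume x: "x \<in> Hom C I V" "x \<cdot> e = Hzero C X V"
    have o: "I \<in> Obj C" "V \<in> Obj C" "J \<in> Obj C" if "k \<in> Hom C J I" for J k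
      using that Hom_Obj x e by blast+
    \<comment> \<open>\<open>f\<close> factors through \<open>m \<cdot> k\<close>, where \<open>k\<close> is the kernel of \<open>x\<close>;
      then \<open>m\<close> factors through \<open>m \<cdot> k\<close>, so \<open>k\<close> has a section.\<close>
    obtain J k where k: "k \<in> Hom C J I" "is_kernel C x k" "is_mono C k" using kernel_obtain[OF x(1)] .
    obtain e' where e': "e' \<in> Hom C X J" "k \<cdot> e' = e" using kernel_lift[OF k(2) x(1) k(1) e(1) x(2)] .
    have mk: "m \<cdot> k \<in> Hom C J Y" "is_mono C (m \<cdot> k)"
      using Comp_closed[OF k(1) m(1)] mono_comp[OF k(3) m(3) k(1) m(1)] by auto
    obtain R d where d: "d \<in> Hom C Y R" "is_cokernel C (m \<cdot> k) d" using cokernel_obtain[OF mk(1)] .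
    have ker: "is_kernel C d (m \<cdot> k)" using mono_kernel_of_cokernel[OF mk(2,1) d(2)] .
    have "f = (m \<cdot> k) \<cdot> e'" using e(2) e'(2) Comp_assoc[OF e'(1) k(1) m(1)] by simp
    then have "d \<cdot> f = (d \<cdot> (m \<cdot> k)) \<cdot> e'" using Comp_assoc[OF e'(1) mk(1) d(1)] by simp
    also have "\<dots> = Hzero C X R"
      using kernel_comp[OF ker d(1) mk(1)] comp_zero_left[OF e'(1)] Hom_Obj d by metis
    finally obtain d' where d': "d' \<in> Hom C Q R" "d' \<cdot> c = d"
      using cokernel_factor[OF c(2) f c(1) d(1)] by blast
    have "d \<cdot> m = d' \<cdot> (c \<cdot> m)" using d' Comp_assoc[OF m(1) c(1) d'(1)] by simp
    also have "\<dots> = Hzero C I R"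
      using kernel_comp[OF m(2) c(1) m(1)] comp_zero_right[OF d'(1)] Hom_Obj m by metis
    finally obtain t where t: "t \<in> Hom C I J" "(m \<cdot> k) \<cdot> t = m"
      using kernel_lift[OF ker d(1) mk(1) m(1)] by blast
    have "m \<cdot> (k \<cdot> t) = m \<cdot> Id C I"
      using t Comp_assoc[OF t(1) k(1) m(1)] Comp_Id_right[OF m(1)] by simp
    then have kt: "k \<cdot> t = Id C I"
      using monoD[OF m(3,1) Comp_closed[OF t(1) k(1)]] Id_closed o(1)[OF k(1)] by blast
    have "x = (x \<cdot> k) \<cdot> t" using Comp_assoc[OF t(1) k(1) x(1)] kt Comp_Id_right[OF x(1)] by simp
    also have "\<dots> = Hzero C I V"
      using kernel_comp[OF k(2) x(1) k(1)] comp_zero_left[OF t(1)] Hom_Obj x by metis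
    finally show "x = Hzero C I V" .
  qed
  then show ?thesis using that e m by blast
qed

definition short_exact where
  "short_exact i p \<longleftrightarrow> is_kernel C p i \<and> is_cokernel C i p"

lemma mono_short_exact:
  assumes "is_mono C i" "i \<in> Hom C K X"
  obtains Q p where "p \<in> Hom C X Q" "short_exact i p"
  using cokernel_obtain[OF assms(2)] mono_kernel_of_cokernel[OF assms] unfolding short_exact_def by metis

lemma epi_short_exact:
  assumes "is_epi C p" "p \<in> Hom C X Q"
  obtains K i where "i \<in> Hom C K X" "short_exact i p"
  using kernel_obtain[OF assms(2)] epi_cokernel_of_kernel[OF assms] unfolding short_exact_def by metis

lemma short_exact_comp:
  assumes "short_exact i p" "i \<in> Hom C K X" "p \<in> Hom C X Q"
  shows "p \<cdot> i = Hzero C K Q"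
  using assms kernel_comp short_exact_def by blast

lemma short_exact_lift:
  assumes "short_exact i p" "i \<in> Hom C K X" "p \<in> Hom C X Q" "h \<in> Hom C W X" "p \<cdot> h = Hzero C W Q"
  obtains u where "u \<in> Hom C W K" "i \<cdot> u = h"
  using assms kernel_lift short_exact_def by metis

lemma short_exact_factor:
  assumes "short_exact i p" "i \<in> Hom C K X" "p \<in> Hom C X Q" "h \<in> Hom C X Z" "h \<cdot> i = Hzero C K Z"
  obtains u where "u \<in> Hom C Q Z" "u \<cdot> p = h"
  using assms cokernel_factor short_exact_def by metis

lemma short_exact_mono: "short_exact i p \<Longrightarrow> is_mono C i" using short_exact_def kernel_mono by blast
lemma short_exact_epi: "short_exact i p \<Longrightarrow> is_epi C p" using short_exact_def cokernel_epi by blast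

text \<open>
  If \<open>r\<close> is a retraction, then \<open>id - i \<cdot> r\<close> vanishes on \<open>i\<close> and induces a section; if \<open>s\<close> is a section,
  then \<open>id - s \<cdot> p\<close> is killed by \<open>p\<close> and induces a retraction.
\<close>
lemma short_exact_split:
  assumes "short_exact i p" "i \<in> Hom C K X" "p \<in> Hom C X Q"
  shows "(\<exists>r \<in> Hom C X K. r \<cdot> i = Id C K) \<longleftrightarrow> (\<exists>s \<in> Hom C Q X. p \<cdot> s = Id C Q)"
proof -
  have o: "K \<in> Obj C" "X \<in> Obj C" "Q \<in> Obj C" using assms Hom_Obj by auto
  note I = Id_closed[OF o(1)] Id_closed[OF o(2)] Id_closed[OF o(3)]
  show ?thesis
  proof
    assume "\<exists>r \<in> Hom C X K. r \<cdot> i = Id C K"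
    then obtain r where r: "r \<in> Hom C X K" "r \<cdot> i = Id C K" by blast
    note ir = Comp_closed[OF r(1) assms(2)]
    let ?d = "diff (Id C X) (i \<cdot> r)"
    have d: "?d \<in> Hom C X X" using diff_closed I ir by blast
    have "(i \<cdot> r) \<cdot> i = i"
      using Comp_assoc[OF assms(2) r(1) assms(2)] r(2) Comp_Id_right[OF assms(2)] by simp
    then have "?d \<cdot> i = Hzero C K X"
      using comp_diff_left[OF I(2) ir assms(2)] Comp_Id_left[OF assms(2)]
        diff_eq_zero[OF assms(2,2)] by simp
    then obtain s where s: "s \<in> Hom C Q X" "s \<cdot> p = ?d" using short_exact_factor[OF assms d] by blast
    have "p \<cdot> (i \<cdot> r) = Hzero C X Q"
      using Comp_assoc[OF r(1) assms(2,3)] short_exact_comp[OF assms] comp_zero_left[OF r(1) o(3)] by simp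
    then have "(p \<cdot> s) \<cdot> p = Id C Q \<cdot> p"
      using Comp_assoc[OF assms(3) s(1) assms(3)] s(2) comp_diff_right[OF I(2) ir assms(3)]
        Comp_Id_right[OF assms(3)] Comp_Id_left[OF assms(3)] diff_zero[OF assms(3)] by simp
    then have "p \<cdot> s = Id C Q"
      using epiD[OF short_exact_epi[OF assms(1)] assms(3) Comp_closed[OF s(1) assms(3)] I(3)] by blast
    then show "\<exists>s \<in> Hom C Q X. p \<cdot> s = Id C Q" using s by blast
  next
    assume "\<exists>s \<in> Hom C Q X. p \<cdot> s = Id C Q"
    then obtain s where s: "s \<in> Hom C Q X" "p \<cdot> s = Id C Q" by blast
    note sp = Comp_closed[OF assms(3) s(1)]
    let ?d = "diff (Id C X) (s \<cdot> p)"
    have d: "?d \<in> Hom C X X" using diff_closed I sp by blast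
    have "p \<cdot> (s \<cdot> p) = p"
      using Comp_assoc[OF assms(3) s(1) assms(3)] s(2) Comp_Id_left[OF assms(3)] by simp
    then have "p \<cdot> ?d = Hzero C X Q"
      using comp_diff_right[OF I(2) sp assms(3)] Comp_Id_right[OF assms(3)]
        diff_eq_zero[OF assms(3,3)] by simp
    then obtain r where r: "r \<in> Hom C X K" "i \<cdot> r = ?d" using short_exact_lift[OF assms d] by blast
    have "(s \<cdot> p) \<cdot> i = Hzero C K X"
      using Comp_assoc[OF assms(2,3) s(1)] short_exact_comp[OF assms] comp_zero_right[OF s(1) o(1)] by simp
    then have "i \<cdot> (r \<cdot> i) = i \<cdot> Id C K"
      using Comp_assoc[OF assms(2) r(1) assms(2)] r(2) comp_diff_left[OF I(2) sp assms(2)]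
        Comp_Id_right[OF assms(2)] Comp_Id_left[OF assms(2)] diff_zero[OF assms(2)] by simp
    then have "r \<cdot> i = Id C K"
      using monoD[OF short_exact_mono[OF assms(1)] assms(2) Comp_closed[OF assms(2) r(1)] I(1)] by blast
    then show "\<exists>r \<in> Hom C X K. r \<cdot> i = Id C K" using r by blast
  qed
qed

text \<open>
  The pullback is the kernel of \<open>\<delta> = (c, - g) : X \<oplus> Z \<rightarrow> Q\<close>. That the projection to \<open>Z\<close> remains epi
  uses that \<open>\<delta>\<close> is epi, hence the cokernel of \<open>P \<rightarrow> X \<oplus> Z\<close>: a morphism on \<open>Z\<close> killed by the
  projection extends by zero to \<open>X \<oplus> Z\<close>, factors through \<open>\<delta>\<close>, and its factor vanishes on \<open>c\<close>.
\<close>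
lemma short_exact_pullback:
  assumes S: "short_exact i c" "i \<in> Hom C K X" "c \<in> Hom C X Q" and g: "g \<in> Hom C Z Q"
  obtains P u p h where "u \<in> Hom C K P" "p \<in> Hom C P Z" "h \<in> Hom C P X"
    "short_exact u p" "h \<cdot> u = i" "c \<cdot> h = g \<cdot> p"
proof -
  have o: "K \<in> Obj C" "X \<in> Obj C" "Q \<in> Obj C" "Z \<in> Obj C" using S g Hom_Obj by auto
  obtain B j1 j2 q1 q2 where "is_biproduct C X Z B j1 j2 q1 q2"
    using biproduct_exists[OF o(2,4)] by blast
  then have b: "j1 \<in> Hom C X B" "j2 \<in> Hom C Z B" "q1 \<in> Hom C B X" "q2 \<in> Hom C B Z"
    "q1 \<cdot> j1 = Id C X" "q2 \<cdot> j2 = Id C Z" "q2 \<cdot> j1 = Hzero C X Z" "q1 \<cdot> j2 = Hzero C Z X"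
    "j1 \<cdot> q1 \<boxplus> j2 \<cdot> q2 = Id C B"
    by (auto simp: is_biproduct_def)
  have cq: "c \<cdot> q1 \<in> Hom C B Q" "g \<cdot> q2 \<in> Hom C B Q" using Comp_closed b S g by blast+
  define \<delta> where "\<delta> = diff (c \<cdot> q1) (g \<cdot> q2)"
  have \<delta>: "\<delta> \<in> Hom C B Q" unfolding \<delta>_def using diff_closed cq by blast
  have \<delta>_comp: "\<delta> \<cdot> x = diff (c \<cdot> (q1 \<cdot> x)) (g \<cdot> (q2 \<cdot> x))" if "x \<in> Hom C W B" for x W
    unfolding \<delta>_def using comp_diff_left[OF cq that] Comp_assoc[OF that b(3) S(3)]
      Comp_assoc[OF that b(4) g] by simp
  have \<delta>_zero: "\<delta> \<cdot> x = Hzero C W Q \<longleftrightarrow> c \<cdot> (q1 \<cdot> x) = g \<cdot> (q2 \<cdot> x)" if "x \<in> Hom C W B" for x W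
    unfolding \<delta>_comp[OF that]
    by (rule diff_eq_zero[OF Comp_closed[OF Comp_closed[OF that b(3)] S(3)]
        Comp_closed[OF Comp_closed[OF that b(4)] g]])
  have \<delta>j1: "\<delta> \<cdot> j1 = c"
    unfolding \<delta>_comp[OF b(1)] using b Comp_Id_right[OF S(3)] comp_zero_right[OF g o(2)]
      diff_zero[OF S(3)] by simp
  have \<delta>_epi: "is_epi C \<delta>"
  proof (rule epi_zeroI[OF \<delta>])
    fix V x assume x: "x \<in> Hom C Q V" "x \<cdot> \<delta> = Hzero C B V"
    have "x \<cdot> c = (x \<cdot> \<delta>) \<cdot> j1" using Comp_assoc[OF b(1) \<delta> x(1)] \<delta>j1 by simp
    also have "\<dots> = Hzero C X V" using x comp_zero_left[OF b(1)] Hom_Obj by metis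
    finally show "x = Hzero C Q V" using epi_zeroD[OF short_exact_epi[OF S(1)] S(3) x(1)] by blast
  qed
  obtain P k where k: "k \<in> Hom C P B" "short_exact k \<delta>" using epi_short_exact[OF \<delta>_epi \<delta>] .
  have P: "P \<in> Obj C" using k Hom_Obj by blast
  define h p where "h = q1 \<cdot> k" and "p = q2 \<cdot> k"
  have hp: "h \<in> Hom C P X" "p \<in> Hom C P Z" unfolding h_def p_def using Comp_closed k b by blast+
  have sq: "c \<cdot> h = g \<cdot> p"
    using \<delta>_zero[OF k(1)] short_exact_comp[OF k(2,1) \<delta>] unfolding h_def p_def by simp
  \<comment> \<open>A morphism into \<open>P\<close> is given by its two components.\<close>
  have lift: "\<exists>u \<in> Hom C W P. h \<cdot> u = x \<and> p \<cdot> u = y"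
    if xy: "x \<in> Hom C W X" "y \<in> Hom C W Z" "c \<cdot> x = g \<cdot> y" for W x y
  proof -
    let ?v = "j1 \<cdot> x \<boxplus> j2 \<cdot> y"
    have t: "j1 \<cdot> x \<in> Hom C W B" "j2 \<cdot> y \<in> Hom C W B" using Comp_closed xy b by blast+
    have v: "?v \<in> Hom C W B" using add_closed t by blast
    have W: "W \<in> Obj C" using xy Hom_Obj by blast
    have "q1 \<cdot> ?v = x"
      using Comp_Hadd_right[OF t b(3)] Comp_assoc[OF xy(1) b(1) b(3)] Comp_assoc[OF xy(2) b(2) b(3)]
        b comp_zero_left[OF xy(2) o(2)] Comp_Id_left[OF xy(1)] add_zero[OF xy(1)] by simp
    moreover have "q2 \<cdot> ?v = y"
      using Comp_Hadd_right[OF t b(4)] Comp_assoc[OF xy(1) b(1) b(4)] Comp_assoc[OF xy(2) b(2) b(4)]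
        b comp_zero_left[OF xy(1) o(4)] Comp_Id_left[OF xy(2)] add_zero[OF xy(2)] by simp
    moreover from calculation have "\<delta> \<cdot> ?v = Hzero C W Q" using \<delta>_zero[OF v] xy(3) by simp
    then obtain u where u: "u \<in> Hom C W P" "k \<cdot> u = ?v" using short_exact_lift[OF k(2,1) \<delta> v] by blast
    ultimately have "h \<cdot> u = x \<and> p \<cdot> u = y"
      unfolding h_def p_def using Comp_assoc[OF u(1) k(1) b(3)] Comp_assoc[OF u(1) k(1) b(4)] by simp
    then show ?thesis using u by blast
  qed
  have joint: "u = v" if uv: "u \<in> Hom C W P" "v \<in> Hom C W P" "h \<cdot> u = h \<cdot> v" "p \<cdot> u = p \<cdot> v" for W u v
  proof -
    have ku: "k \<cdot> u \<in> Hom C W B" "k \<cdot> v \<in> Hom C W B" using Comp_closed k uv by blast+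
    have e: "x = j1 \<cdot> (q1 \<cdot> x) \<boxplus> j2 \<cdot> (q2 \<cdot> x)" if "x \<in> Hom C W B" for x
      using Comp_Hadd_left[OF that Comp_closed[OF b(3,1)] Comp_closed[OF b(4,2)]] b(9)
        Comp_Id_left[OF that] Comp_assoc[OF that b(3,1)] Comp_assoc[OF that b(4,2)] by simp
    have "q1 \<cdot> (k \<cdot> u) = q1 \<cdot> (k \<cdot> v)" "q2 \<cdot> (k \<cdot> u) = q2 \<cdot> (k \<cdot> v)"
      using uv(3,4) Comp_assoc[OF uv(1) k(1)] Comp_assoc[OF uv(2) k(1)] b unfolding h_def p_def by auto
    then have "k \<cdot> u = k \<cdot> v" using e[OF ku(1)] e[OF ku(2)] by simp
    then show ?thesis using monoD[OF short_exact_mono[OF k(2)] k(1) uv(1,2)] by blast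
  qed
  have "c \<cdot> i = g \<cdot> Hzero C K Z" using short_exact_comp[OF S] comp_zero_right[OF g o(1)] by simp
  then obtain u where u: "u \<in> Hom C K P" "h \<cdot> u = i" "p \<cdot> u = Hzero C K Z"
    using lift[OF S(2) zero_closed[OF o(1,4)]] by blast
  have "is_mono C u"
  proof (rule mono_zeroI[OF u(1)])
    fix W x assume x: "x \<in> Hom C W K" "u \<cdot> x = Hzero C W P"
    have "i \<cdot> x = h \<cdot> (u \<cdot> x)" using Comp_assoc[OF x(1) u(1) hp(1)] u(2) by simp
    also have "\<dots> = Hzero C W X" using x comp_zero_right[OF hp(1)] Hom_Obj by metis
    finally show "x = Hzero C W K" using mono_zeroD[OF short_exact_mono[OF S(1)] S(2) x(1)] by blast
  qed
  then have ker: "is_kernel C p u"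
  proof (rule kernelI[OF hp(2) _ u(1,3)])
    fix W x assume x: "x \<in> Hom C W P" "p \<cdot> x = Hzero C W Z"
    have W: "W \<in> Obj C" using x Hom_Obj by blast
    have "c \<cdot> (h \<cdot> x) = g \<cdot> (p \<cdot> x)"
      using sq Comp_assoc[OF x(1) hp(1) S(3)] Comp_assoc[OF x(1) hp(2) g] by simp
    then have "c \<cdot> (h \<cdot> x) = Hzero C W Q" using x(2) comp_zero_right[OF g W] by simp
    then obtain t where t: "t \<in> Hom C W K" "i \<cdot> t = h \<cdot> x"
      using short_exact_lift[OF S Comp_closed[OF x(1) hp(1)]] by blast
    have "u \<cdot> t = x"
    proof (rule joint[OF Comp_closed[OF t(1) u(1)] x(1)])
      show "h \<cdot> (u \<cdot> t) = h \<cdot> x" using Comp_assoc[OF t(1) u(1) hp(1)] u(2) t(2) by simp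
      show "p \<cdot> (u \<cdot> t) = p \<cdot> x"
        using Comp_assoc[OF t(1) u(1) hp(2)] u(3) x(2) comp_zero_left[OF t(1) o(4)] by simp
    qed
    then show "\<exists>t\<in>Hom C W K. u \<cdot> t = x" using t by blast
  qed
  have "is_epi C p"
  proof (rule epi_zeroI[OF hp(2)])
    fix V x assume x: "x \<in> Hom C Z V" "x \<cdot> p = Hzero C P V"
    have V: "V \<in> Obj C" using x Hom_Obj by blast
    note xq = Comp_closed[OF b(4) x(1)]
    have "(x \<cdot> q2) \<cdot> k = Hzero C P V" using x(2) Comp_assoc[OF k(1) b(4) x(1)] unfolding p_def by simp
    then obtain y where y: "y \<in> Hom C Q V" "y \<cdot> \<delta> = x \<cdot> q2" using short_exact_factor[OF k(2,1) \<delta> xq] by blast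
    have "y \<cdot> c = (x \<cdot> q2) \<cdot> j1" using \<delta>j1 Comp_assoc[OF b(1) \<delta> y(1)] y(2) by simp
    also have "\<dots> = Hzero C X V" using Comp_assoc[OF b(1,4) x(1)] b comp_zero_right[OF x(1) o(2)] by simp
    finally have "y = Hzero C Q V" using epi_zeroD[OF short_exact_epi[OF S(1)] S(3) y(1)] by blast
    then have "x \<cdot> q2 = Hzero C B V" using y(2) comp_zero_left[OF \<delta> V] by simp
    then have "(x \<cdot> q2) \<cdot> j2 = Hzero C Z V" using comp_zero_left[OF b(2) V] by simp
    then show "x = Hzero C Z V" using Comp_assoc[OF b(2,4) x(1)] b Comp_Id_right[OF x(1)] by simp
  qed
  then have "short_exact u p" unfolding short_exact_def using ker epi_cokernel_of_kernel hp by blast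
  then show ?thesis using that u hp sq by blast
qed

lemma short_exact_pushout:
  assumes S: "short_exact u p" "u \<in> Hom C K P" "p \<in> Hom C P Z" and k: "k \<in> Hom C K B"
  obtains X i q v where "i \<in> Hom C B X" "q \<in> Hom C X Z" "v \<in> Hom C P X"
    "short_exact i q" "q \<cdot> v = p" "v \<cdot> u = i \<cdot> k"
proof -
  interpret op: abelian_category "op_cat C" by (rule op_cat_abelian) unfold_locales
  have [simp]: "op.short_exact a b \<longleftrightarrow> short_exact b a" for a b by (auto simp: op.short_exact_def short_exact_def)
  show ?thesis
    by (rule op.short_exact_pullback[of p u Z P K k B]) (use that S k in simp_all)
qed

section \<open>Composition length\<close>

lemma epi_zero_cod:
  assumes "e \<in> Hom C X Q" "is_epi C e" "e = Hzero C X Q"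
  shows "is_zero_obj C Q"
proof -
  have o: "X \<in> Obj C" "Q \<in> Obj C" using assms Hom_Obj by auto
  have "Id C Q \<cdot> e = Hzero C X Q" using Comp_Id_left[OF assms(1)] assms(3) by simp
  then show ?thesis using epi_zeroD[OF assms(2,1) Id_closed[OF o(2)]] o zero_obj_iff by blast
qed

lemma mono_zero_dom:
  assumes "m \<in> Hom C K X" "is_mono C m" "m = Hzero C K X"
  shows "is_zero_obj C K"
proof -
  have o: "K \<in> Obj C" "X \<in> Obj C" using assms Hom_Obj by auto
  have "m \<cdot> Id C K = Hzero C K X" using Comp_Id_right[OF assms(1)] assms(3) by simp
  then show ?thesis using mono_zeroD[OF assms(2,1) Id_closed[OF o(1)]] o zero_obj_iff by blast
qed

lemma zero_kernel_mono:
  assumes "short_exact k f" "k \<in> Hom C K X" "f \<in> Hom C X Y" "is_zero_obj C K"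
  shows "is_mono C f"
proof (rule mono_zeroI[OF assms(3)])
  fix W g assume g: "g \<in> Hom C W X" "f \<cdot> g = Hzero C W Y"
  obtain u where u: "u \<in> Hom C W K" "k \<cdot> u = g" using short_exact_lift[OF assms(1-3) g] .
  then show "g = Hzero C W X"
    using zero_obj_hom(2)[OF assms(4) u(1)] comp_zero_right[OF assms(2)] Hom_Obj by metis
qed

lemma zero_cokernel_epi:
  assumes "short_exact f c" "f \<in> Hom C X Y" "c \<in> Hom C Y Q" "is_zero_obj C Q"
  shows "is_epi C f"
proof (rule epi_zeroI[OF assms(2)])
  fix Z g assume g: "g \<in> Hom C Y Z" "g \<cdot> f = Hzero C X Z"
  obtain u where u: "u \<in> Hom C Q Z" "u \<cdot> c = g" using short_exact_factor[OF assms(1-3) g] .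
  then show "g = Hzero C Y Z"
    using zero_obj_hom(1)[OF assms(4) u(1)] comp_zero_left[OF assms(3)] Hom_Obj by metis
qed

lemma short_exact_iso_zero:
  assumes "short_exact i c" "i \<in> Hom C K X" "c \<in> Hom C X Q" "is_iso C i"
  shows "is_zero_obj C Q"
proof -
  have "c = Hzero C X Q"
    using epi_zeroD[OF iso_epi[OF assms(4)] assms(2,3)] short_exact_comp[OF assms(1-3)] by blast
  then show ?thesis using epi_zero_cod[OF assms(3) short_exact_epi[OF assms(1)]] by blast
qed

lemma short_exact_mono_zero:
  assumes "short_exact i c" "i \<in> Hom C K X" "c \<in> Hom C X Q" "is_mono C c"
  shows "is_zero_obj C K"
proof -
  have "i = Hzero C K X"
    using mono_zeroD[OF assms(4,3,2)] short_exact_comp[OF assms(1-3)] by blast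
  then show ?thesis using mono_zero_dom[OF assms(2) short_exact_mono[OF assms(1)]] by blast
qed

lemma simple_map_epi:
  assumes "simple_obj C S" "f \<in> Hom C X S" "f \<noteq> Hzero C X S"
  shows "is_epi C f"
proof -
  obtain I e m where em: "e \<in> Hom C X I" "m \<in> Hom C I S" "is_epi C e" "is_mono C m" "f = m \<cdot> e"
    using image_factorization[OF assms(2)] .
  have "\<not> is_zero_obj C I"
  proof
    assume "is_zero_obj C I"
    then have "m = Hzero C I S" using zero_obj_hom(1) em by blast
    then have "f = Hzero C X S" using em comp_zero_left[OF em(1)] Hom_Obj by metis
    then show False using assms by blast
  qed
  moreover have "Cod C m = S" "Dom C m = I" using em by (auto simp: Hom_def)
  ultimately have "is_iso C m" using assms(1) em(4) unfolding simple_obj_def by blast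
  then show ?thesis using epi_comp[OF em(3) iso_epi em(1,2)] em(5) by blast
qed

lemma simple_quotient:
  assumes "simple_obj C S" "e \<in> Hom C S Q" "is_epi C e" "\<not> is_zero_obj C Q"
  shows "is_iso C e"
proof -
  obtain K k where k: "k \<in> Hom C K S" "short_exact k e" using epi_short_exact[OF assms(3,2)] .
  have km: "is_mono C k" "Cod C k = S" "Dom C k = K" using k short_exact_mono by (auto simp: Hom_def)
  have "\<not> is_iso C k" using short_exact_iso_zero[OF k(2,1) assms(2)] assms(4) by blast
  then have "is_zero_obj C K" using assms(1) km unfolding simple_obj_def by blast
  then have "is_mono C e" using zero_kernel_mono[OF k(2,1) assms(2)] by blast
  then show ?thesis using mono_epi_iso assms(3) by blast
qed

definition series_length where
  "series_length X n \<longleftrightarrow> (\<exists>Xs m. composition_series C X n Xs m)"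

lemma series_length_0: "series_length X 0 \<longleftrightarrow> is_zero_obj C X"
  unfolding series_length_def composition_series_def by auto

lemma series_length_Suc:
  "series_length X (Suc n) \<longleftrightarrow> (\<exists>Y S i c. i \<in> Hom C Y X \<and> c \<in> Hom C X S \<and> short_exact i c \<and> simple_obj C S \<and> series_length Y n)"
proof
  assume "series_length X (Suc n)"
  then obtain Xs m where s: "composition_series C X (Suc n) Xs m" by (auto simp: series_length_def)
  then have "series_length (Xs n) n" unfolding series_length_def composition_series_def by (intro exI[of _ Xs] exI[of _ m]) auto
  moreover obtain c where m: "m n \<in> Hom C (Xs n) X" "is_mono C (m n)" "is_cokernel C (m n) c"
    "simple_obj C (Cod C c)" using s unfolding composition_series_def by blast
  moreover have "short_exact (m n) c" using mono_kernel_of_cokernel m unfolding short_exact_def by blast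
  ultimately show "\<exists>Y S i c. i \<in> Hom C Y X \<and> c \<in> Hom C X S \<and> short_exact i c \<and> simple_obj C S \<and> series_length Y n"
    using cokernel_hom by blast
next
  assume "\<exists>Y S i c. i \<in> Hom C Y X \<and> c \<in> Hom C X S \<and> short_exact i c \<and> simple_obj C S \<and> series_length Y n"
  then obtain Y S i c Xs m where i: "i \<in> Hom C Y X" "c \<in> Hom C X S" "short_exact i c" "simple_obj C S"
    and s: "composition_series C Y n Xs m" unfolding series_length_def by blast
  have "Cod C c = S" using i by (simp add: Hom_def)
  then have "composition_series C X (Suc n) (Xs(Suc n := X)) (m(n := i))"
    using s i short_exact_mono[OF i(3)] unfolding composition_series_def short_exact_def
    by (auto simp: less_Suc_eq)
  then show "series_length X (Suc n)" unfolding series_length_def by blast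
qed

text \<open>
  The half of the Jordan--Hoelder theorem that concerns subobjects. Let \<open>X'\<close> be the penultimate
  term of the series, so that \<open>X / X' = S\<close> is simple. Either \<open>Y\<close> lies in \<open>X'\<close>, or \<open>Y\<close> maps onto \<open>S\<close>
  and a series of \<open>Y \<inter> X'\<close> is prolonged by the step with quotient \<open>S\<close>.
\<close>
lemma series_length_mono:
  assumes "series_length X n" "f \<in> Hom C Y X" "is_mono C f"
  shows "\<exists>k\<le>n. series_length Y k \<and> (k = n \<longrightarrow> is_iso C f)"
  using assms
proof (induction n arbitrary: X Y f)
  case 0
  then have X: "is_zero_obj C X" by (simp add: series_length_0)
  have fz: "f = Hzero C Y X" using zero_obj_hom(2)[OF X] 0 by blast
  have Y: "is_zero_obj C Y" using mono_zero_dom[OF 0(2,3) fz] .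
  have "is_epi C f"
    using epi_zeroI[OF 0(2)] zero_obj_hom(1)[OF X] by blast
  then show ?case using Y mono_epi_iso 0 series_length_0 by auto
next
  case (Suc n)
  then obtain X' S i c where i: "i \<in> Hom C X' X" "c \<in> Hom C X S" "short_exact i c" "simple_obj C S" "series_length X' n"
    using series_length_Suc by blast
  note f = Suc.prems(2,3)
  have cf: "c \<cdot> f \<in> Hom C Y S" using Comp_closed f i by blast
  show ?case
  proof (cases "c \<cdot> f = Hzero C Y S")
    case True
    obtain u where u: "u \<in> Hom C Y X'" "i \<cdot> u = f" using short_exact_lift[OF i(3,1,2) f(1) True] .
    then have "is_mono C u" using mono_cancel[OF u(1) i(1)] f(2) u(2) by simp
    then obtain k where "k \<le> n" "series_length Y k" using Suc.IH[OF i(5) u(1)] by blast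
    then show ?thesis by (metis le_SucI not_less_eq_eq)
  next
    case False
    have e: "is_epi C (c \<cdot> f)" using simple_map_epi[OF i(4) cf False] .
    obtain Y' j where j: "j \<in> Hom C Y' Y" "short_exact j (c \<cdot> f)" using epi_short_exact[OF e cf] .
    note fj = Comp_closed[OF j(1) f(1)]
    have "c \<cdot> (f \<cdot> j) = Hzero C Y' S"
      using Comp_assoc[OF j(1) f(1) i(2)] short_exact_comp[OF j(2,1) cf] by simp
    then obtain u where u: "u \<in> Hom C Y' X'" "i \<cdot> u = f \<cdot> j"
      using short_exact_lift[OF i(3,1,2) fj] by blast
    have fjm: "is_mono C (f \<cdot> j)" using mono_comp[OF short_exact_mono[OF j(2)] f(2) j(1) f(1)] .
    then have "is_mono C u" using mono_cancel[OF u(1) i(1)] fjm u(2) by simp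
    then obtain k where k: "k \<le> n" "series_length Y' k" "k = n \<longrightarrow> is_iso C u"
      using Suc.IH[OF i(5) u(1)] by blast
    have "series_length Y (Suc k)" using series_length_Suc j cf i(4) k(2) by blast
    moreover have "is_iso C f" if "is_iso C u"
    proof -
      have "is_epi C f"
      proof (rule epi_zeroI[OF f(1)])
        fix Z g assume g: "g \<in> Hom C X Z" "g \<cdot> f = Hzero C Y Z"
        have o: "Z \<in> Obj C" "Y' \<in> Obj C" "S \<in> Obj C" "X' \<in> Obj C" "X \<in> Obj C"
          using g j i Hom_Obj by auto
        have "(g \<cdot> i) \<cdot> u = (g \<cdot> f) \<cdot> j"
          using Comp_assoc[OF u(1) i(1) g(1)] Comp_assoc[OF j(1) f(1) g(1)] u(2) by simp
        also have "\<dots> = Hzero C Y' Z" using g comp_zero_left[OF j(1)] o by simp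
        finally have "g \<cdot> i = Hzero C X' Z"
          using epi_zeroD[OF iso_epi[OF that] u(1) Comp_closed[OF i(1) g(1)]] by blast
        then obtain g' where g': "g' \<in> Hom C S Z" "g' \<cdot> c = g" using short_exact_factor[OF i(3,1,2) g(1)] by blast
        have "g' \<cdot> (c \<cdot> f) = Hzero C Y Z" using Comp_assoc[OF f(1) i(2) g'(1)] g' g by simp
        then have "g' = Hzero C S Z" using epi_zeroD[OF e cf g'(1)] by blast
        then show "g = Hzero C X Z" using g' comp_zero_left[OF i(2) o(1)] by simp
      qed
      then show ?thesis using mono_epi_iso f by blast
    qed
    ultimately show ?thesis using k by (intro exI[of _ "Suc k"]) auto
  qed
qed

text \<open>
  The image \<open>Q'\<close> of the penultimate term \<open>X'\<close> in \<open>Q\<close> has a quotient \<open>Q / Q' = D\<close> that is itself a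
  quotient of the simple object \<open>S = X / X'\<close>, hence zero or isomorphic to \<open>S\<close>.
\<close>
lemma series_length_epi:
  assumes "series_length X n" "f \<in> Hom C X Q" "is_epi C f"
  shows "\<exists>k\<le>n. series_length Q k \<and> (k = n \<longrightarrow> is_iso C f)"
  using assms
proof (induction n arbitrary: X Q f)
  case 0
  then have X: "is_zero_obj C X" by (simp add: series_length_0)
  have fz: "f = Hzero C X Q" using zero_obj_hom(1)[OF X] 0 by blast
  have Q: "is_zero_obj C Q" using epi_zero_cod[OF 0(2,3) fz] .
  have "is_mono C f"
    using mono_zeroI[OF 0(2)] zero_obj_hom(2)[OF X] by blast
  then show ?case using Q mono_epi_iso 0 series_length_0 by auto
next
  case (Suc n)
  then obtain X' S i c where i: "i \<in> Hom C X' X" "c \<in> Hom C X S" "short_exact i c" "simple_obj C S" "series_length X' n"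
    using series_length_Suc by blast
  note f = Suc.prems(2,3)
  note fi = Comp_closed[OF i(1) f(1)]
  obtain Q' e m where em: "e \<in> Hom C X' Q'" "m \<in> Hom C Q' Q" "is_epi C e" "is_mono C m" "f \<cdot> i = m \<cdot> e"
    using image_factorization[OF fi] .
  obtain k where k: "k \<le> n" "series_length Q' k" "k = n \<longrightarrow> is_iso C e"
    using Suc.IH[OF i(5) em(1,3)] by blast
  obtain D d where d: "d \<in> Hom C Q D" "short_exact m d" using mono_short_exact[OF em(4,2)] .
  have o: "D \<in> Obj C" "X' \<in> Obj C" "Q \<in> Obj C" "Q' \<in> Obj C" using d em Hom_Obj by auto
  note df = Comp_closed[OF f(1) d(1)]
  have "(d \<cdot> f) \<cdot> i = (d \<cdot> m) \<cdot> e"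
    using Comp_assoc[OF i(1) f(1) d(1)] Comp_assoc[OF em(1,2) d(1)] em(5) by simp
  also have "\<dots> = Hzero C X' D" using short_exact_comp[OF d(2) em(2) d(1)] comp_zero_left[OF em(1) o(1)] by simp
  finally obtain g where g: "g \<in> Hom C S D" "g \<cdot> c = d \<cdot> f" using short_exact_factor[OF i(3,1,2) df] by blast
  have dfe: "is_epi C (d \<cdot> f)" using epi_comp[OF f(2) short_exact_epi[OF d(2)] f(1) d(1)] .
  show ?case
  proof (cases "is_zero_obj C D")
    case True
    then have "is_epi C m" using zero_cokernel_epi[OF d(2) em(2) d(1)] by blast
    then have "is_iso C m" using mono_epi_iso em by blast
    then obtain m' where m': "m' \<in> Hom C Q Q'" "m' \<cdot> m = Id C Q'" "m \<cdot> m' = Id C Q" using isoE em by metis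
    then have "is_iso C m'" using isoI[OF m'(1) em(2)] by blast
    then obtain l where "l \<le> k" "series_length Q l" using series_length_mono[OF k(2) m'(1)] iso_mono by blast
    then show ?thesis using k by (metis le_SucI not_less_eq_eq order_trans)
  next
    case False
    have "is_epi C g" using epi_cancel[OF i(2) g(1)] g(2) dfe by simp
    then have gi: "is_iso C g" using simple_quotient[OF i(4) g(1)] False by blast
    then obtain g' where g': "g' \<in> Hom C D S" "g' \<cdot> g = Id C S" "g \<cdot> g' = Id C D" using isoE g by metis
    have "is_iso C g'" using isoI[OF g'(1) g(1)] g' by blast
    have sD: "simple_obj C D"
      unfolding simple_obj_def
    proof (intro conjI allI impI)
      show "D \<in> Obj C" "\<not> is_zero_obj C D" using o False by auto
      fix h assume h: "is_mono C h \<and> Cod C h = D"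
      define K where "K = Dom C h"
      have hh: "h \<in> Hom C K D" using h by (auto simp: is_mono_def Hom_def K_def)
      note gh = Comp_closed[OF hh g'(1)]
      have gm: "is_mono C (g' \<cdot> h)" using mono_comp[OF _ iso_mono hh g'(1)] h \<open>is_iso C g'\<close> by blast
      have "Cod C (g' \<cdot> h) = S" "Dom C (g' \<cdot> h) = K" using gh by (auto simp: Hom_def)
      then have "is_zero_obj C K \<or> is_iso C (g' \<cdot> h)" using i(4) gm unfolding simple_obj_def by blast
      moreover have "is_iso C h" if "is_iso C (g' \<cdot> h)"
      proof -
        have "g \<cdot> (g' \<cdot> h) = h" using Comp_assoc[OF hh g'(1) g(1)] g'(3) Comp_Id_left[OF hh] by simp
        then show ?thesis using iso_comp[OF that gi gh g(1)] by simp
      qed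
      ultimately show "is_zero_obj C (Dom C h) \<or> is_iso C h" unfolding K_def by blast
    qed
    then have "series_length Q (Suc k)" using series_length_Suc em d k by blast
    moreover have "is_iso C f" if ei: "is_iso C e"
    proof -
      have "is_mono C f"
      proof (rule mono_zeroI[OF f(1)])
        fix W x assume x: "x \<in> Hom C W X" "f \<cdot> x = Hzero C W Q"
        have W: "W \<in> Obj C" using x Hom_Obj by blast
        have "g \<cdot> (c \<cdot> x) = d \<cdot> (f \<cdot> x)"
          using Comp_assoc[OF x(1) i(2) g(1)] Comp_assoc[OF x(1) f(1) d(1)] g(2) by simp
        also have "\<dots> = Hzero C W D" using x(2) comp_zero_right[OF d(1) W] by simp
        finally have "c \<cdot> x = Hzero C W S"
          using mono_zeroD[OF iso_mono[OF gi] g(1) Comp_closed[OF x(1) i(2)]] by blast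
        then obtain y where y: "y \<in> Hom C W X'" "i \<cdot> y = x" using short_exact_lift[OF i(3,1,2) x(1)] by blast
        have "(m \<cdot> e) \<cdot> y = Hzero C W Q"
          using Comp_assoc[OF y(1) i(1) f(1)] y(2) x(2) em(5) by simp
        moreover have "is_mono C (m \<cdot> e)" using mono_comp[OF iso_mono[OF ei] em(4,1,2)] .
        ultimately have "y = Hzero C W X'"
          using mono_zeroD[OF _ Comp_closed[OF em(1,2)] y(1)] by blast
        then show "x = Hzero C W X" using y(2) comp_zero_right[OF i(1) W] by simp
      qed
      then show ?thesis using mono_epi_iso f by blast
    qed
    ultimately show ?thesis using k by (intro exI[of _ "Suc k"]) auto
  qed
qed

end

context abelian_length_category begin

text \<open>
  The least length of a series increases strictly along proper monomorphisms, so it is at least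
  the number of steps of any given series.
\<close>
lemma series_length_unique:
  assumes "series_length X n" "series_length X k" shows "n = k"
proof -
  define len where "len X = (LEAST n. series_length X n)" for X
  have least: "series_length X (len X) \<and> len X \<le> n" if "series_length X n" for X n
    unfolding len_def using that LeastI Least_le by metis
  have "n \<le> len X" if "series_length X n" for X n
    using that
  proof (induction n arbitrary: X)
    case (Suc n)
    obtain Y S i c where i: "i \<in> Hom C Y X" "c \<in> Hom C X S" "short_exact i c" "simple_obj C S" "series_length Y n"
      using Suc.prems series_length_Suc by blast
    have "\<not> is_iso C i"
      using short_exact_iso_zero[OF i(3,1,2)] i(4) by (auto simp: simple_obj_def)
    then obtain l where "l < len X" "series_length Y l"
      using series_length_mono[OF _ i(1) short_exact_mono[OF i(3)], of "len X"] least[OF Suc.prems] le_neq_implies_less by blast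
    then show ?case using Suc.IH[OF i(5)] least[of Y l] by linarith
  qed simp
  then show ?thesis using assms least by (metis order_antisym)
qed

lemma obj_length_eq:
  assumes "series_length X n" shows "obj_length C X = n"
  using the_equality[of "series_length X" n] assms series_length_unique unfolding obj_length_def series_length_def by blast

lemma obj_length_series:
  assumes "X \<in> Obj C" shows "series_length X (obj_length C X)"
  using composition_series_exists[OF assms] obj_length_eq unfolding series_length_def by metis

lemma length_mono:
  assumes "f \<in> Hom C Y X" "is_mono C f"
  shows "obj_length C Y \<le> obj_length C X" "obj_length C X \<le> obj_length C Y \<Longrightarrow> is_iso C f"
proof -
  have "X \<in> Obj C" using assms Hom_Obj by blast
  then obtain k where "k \<le> obj_length C X" "series_length Y k" "k = obj_length C X \<longrightarrow> is_iso C f"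
    using series_length_mono[OF obj_length_series assms] by blast
  then show "obj_length C Y \<le> obj_length C X" "obj_length C X \<le> obj_length C Y \<Longrightarrow> is_iso C f"
    using obj_length_eq by auto
qed

lemma length_epi:
  assumes "f \<in> Hom C X Q" "is_epi C f"
  shows "obj_length C Q \<le> obj_length C X" "obj_length C X \<le> obj_length C Q \<Longrightarrow> is_iso C f"
proof -
  have "X \<in> Obj C" using assms Hom_Obj by blast
  then obtain k where "k \<le> obj_length C X" "series_length Q k" "k = obj_length C X \<longrightarrow> is_iso C f"
    using series_length_epi[OF obj_length_series assms] by blast
  then show "obj_length C Q \<le> obj_length C X" "obj_length C X \<le> obj_length C Q \<Longrightarrow> is_iso C f"
    using obj_length_eq by auto
qed

lemma length_iso: "(X, Y) \<in> iso_rel C \<Longrightarrow> obj_length C X = obj_length C Y"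
  unfolding iso_rel_def using length_mono(1) length_epi(1) iso_mono iso_epi by (auto intro!: order_antisym)

lemma endo_mono_iso: "f \<in> Hom C X X \<Longrightarrow> is_mono C f \<Longrightarrow> is_iso C f"
  using length_mono(2) by blast

section \<open>Bricks and non-split extensions\<close>

lemma brick_iff:
  "brick C B \<longleftrightarrow> B \<in> Obj C \<and> \<not> is_zero_obj C B \<and> (\<forall>f \<in> Hom C B B. f \<noteq> Hzero C B B \<longrightarrow> is_iso C f)"
proof (cases "B \<in> Obj C")
  case True
  have u: "Units (End_ring C B) = {f \<in> Hom C B B. is_iso C f}"
    unfolding Units_def End_ring_def by (auto simp: is_iso_def Hom_def)
  have z: "\<not> is_iso C (Hzero C B B)" if "\<not> is_zero_obj C B"
    using iso_mono mono_zero_dom[of "Hzero C B B" B B] zero_closed True that by blast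
  have "skew_field (End_ring C B) \<longleftrightarrow> \<not> is_zero_obj C B \<and> (\<forall>f \<in> Hom C B B. f \<noteq> Hzero C B B \<longrightarrow> is_iso C f)"
    unfolding skew_field_def u using End_ring_is_ring[OF True] True z
    by (auto simp: End_ring_def zero_obj_iff)
  then show ?thesis unfolding brick_def using True by blast
qed (simp add: brick_def)

lemma brickI:
  assumes "B \<in> Obj C" "\<not> is_zero_obj C B"
    and "\<And>f. f \<in> Hom C B B \<Longrightarrow> f \<noteq> Hzero C B B \<Longrightarrow> is_mono C f"
  shows "brick C B"
  using assms endo_mono_iso brick_iff by blast

definition maps_to where
  "maps_to X Y \<longleftrightarrow> (\<exists>f \<in> Hom C X Y. f \<noteq> Hzero C X Y)"

lemma maps_to_mono:
  assumes "maps_to X Y" "m \<in> Hom C Y Z" "is_mono C m" shows "maps_to X Z"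
  using assms mono_zeroD Comp_closed unfolding maps_to_def by metis

lemma maps_to_epi:
  assumes "maps_to X Y" "e \<in> Hom C W X" "is_epi C e" shows "maps_to W Y"
  using assms epi_zeroD Comp_closed unfolding maps_to_def by metis

lemma maps_to_iso:
  assumes "(Y, Z) \<in> iso_rel C" shows "maps_to X Y \<longleftrightarrow> maps_to X Z"
proof -
  have "maps_to X Z" if "maps_to X Y" "(Y, Z) \<in> iso_rel C" for Y Z
    using that maps_to_mono iso_mono unfolding iso_rel_def by blast
  then show ?thesis using assms iso_rel_equiv by (meson equivE symE)
qed

lemma maps_to_iso_dom:
  assumes "(Y, Z) \<in> iso_rel C" shows "maps_to Y X \<longleftrightarrow> maps_to Z X"
proof -
  have "maps_to Y X" if "maps_to Z X" "(Y, Z) \<in> iso_rel C" for Y Z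
    using that maps_to_epi iso_epi unfolding iso_rel_def by blast
  then show ?thesis using assms iso_rel_equiv by (meson equivE symE)
qed

lemma nonzero_image:
  assumes "f \<in> Hom C X Y" "f \<noteq> Hzero C X Y"
  obtains I e m where "e \<in> Hom C X I" "m \<in> Hom C I Y" "is_epi C e" "is_mono C m" "f = m \<cdot> e"
    "\<not> is_zero_obj C I" "m \<noteq> Hzero C I Y"
proof -
  obtain I e m where em: "e \<in> Hom C X I" "m \<in> Hom C I Y" "is_epi C e" "is_mono C m" "f = m \<cdot> e"
    using image_factorization[OF assms(1)] .
  have "m \<noteq> Hzero C I Y" using em assms(2) comp_zero_left[OF em(1)] Hom_Obj by metis
  then show ?thesis using that em zero_obj_hom(1) by blast
qed

text \<open>
  Among the objects that are both quotients and subobjects of \<open>Q\<close>, that is, images of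
  endomorphisms of \<open>Q\<close>, a shortest non-zero one is a brick, because the image of a non-zero
  endomorphism of it is an object of the same kind.
\<close>
lemma brick_quotient_subobject:
  assumes "Q \<in> Obj C" "\<not> is_zero_obj C Q"
  obtains D e m where "brick C D" "e \<in> Hom C Q D" "is_epi C e" "m \<in> Hom C D Q" "is_mono C m"
proof -
  define P where "P D \<longleftrightarrow> \<not> is_zero_obj C D \<and> (\<exists>e \<in> Hom C Q D. is_epi C e) \<and> (\<exists>m \<in> Hom C D Q. is_mono C m)" for D
  have "is_iso C (Id C Q)" using Id_iso assms by blast
  then have "P Q" unfolding P_def using Id_closed iso_mono iso_epi assms by blast
  then obtain D where D: "P D" "\<And>D'. P D' \<Longrightarrow> obj_length C D \<le> obj_length C D'"
    using ex_has_least_nat[of P Q "obj_length C"] by blast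
  obtain e m where em: "e \<in> Hom C Q D" "is_epi C e" "m \<in> Hom C D Q" "is_mono C m"
    using D(1) unfolding P_def by blast
  have "brick C D"
  proof (rule brickI)
    show "D \<in> Obj C" "\<not> is_zero_obj C D" using em Hom_Obj D unfolding P_def by auto
    fix g assume g: "g \<in> Hom C D D" "g \<noteq> Hzero C D D"
    obtain I e' m' where I: "e' \<in> Hom C D I" "m' \<in> Hom C I D" "is_epi C e'" "is_mono C m'"
      "g = m' \<cdot> e'" "\<not> is_zero_obj C I" using nonzero_image[OF g] by metis
    have "P I" unfolding P_def
      using I epi_comp[OF em(2) I(3) em(1) I(1)] mono_comp[OF I(4) em(4) I(2) em(3)] em Comp_closed by blast
    then have "is_iso C e'" using length_epi(2)[OF I(1,3)] D(2) by blast
    then show "is_mono C g" using mono_comp[OF iso_mono I(4,1,2)] I(5) by blast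
  qed
  then show ?thesis using that em by blast
qed

lemma simple_subobject:
  assumes "X \<in> Obj C" "\<not> is_zero_obj C X"
  obtains S m where "simple_obj C S" "m \<in> Hom C S X" "is_mono C m"
proof -
  define P where "P D \<longleftrightarrow> \<not> is_zero_obj C D \<and> (\<exists>m \<in> Hom C D X. is_mono C m)" for D
  have "is_iso C (Id C X)" using Id_iso assms by blast
  then have "P X" unfolding P_def using Id_closed iso_mono assms by blast
  then obtain S where S: "P S" "\<And>D'. P D' \<Longrightarrow> obj_length C S \<le> obj_length C D'"
    using ex_has_least_nat[of P X "obj_length C"] by blast
  obtain m where m: "m \<in> Hom C S X" "is_mono C m" using S(1) unfolding P_def by blast
  have "simple_obj C S" unfolding simple_obj_def
  proof (intro conjI allI impI)
    show "S \<in> Obj C" "\<not> is_zero_obj C S" using m Hom_Obj S unfolding P_def by auto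
    fix h assume h: "is_mono C h \<and> Cod C h = S"
    then have hh: "h \<in> Hom C (Dom C h) S" by (auto simp: is_mono_def Hom_def)
    show "is_zero_obj C (Dom C h) \<or> is_iso C h"
    proof (cases "is_zero_obj C (Dom C h)")
      case False
      have "P (Dom C h)" unfolding P_def
        using False mono_comp[OF _ m(2) hh m(1)] h Comp_closed[OF hh m(1)] by blast
      then show ?thesis using length_mono(2)[OF hh] h S(2) by blast
    qed simp
  qed
  then show ?thesis using that m by blast
qed

text \<open>
  As there is no non-zero map from \<open>D\<close> to \<open>E\<close>, an endomorphism \<open>g\<close> of \<open>X\<close> induces endomorphisms
  \<open>g1\<close> of \<open>D\<close> and \<open>g2\<close> of \<open>E\<close>, each of which is zero or invertible. If exactly one of them were
  zero, the sequence would split; if both are, \<open>g\<close> comes from a map from \<open>E\<close> to \<open>D\<close> and vanishes.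
\<close>
lemma nonsplit_extension_brick:
  assumes S: "short_exact i p" "i \<in> Hom C D X" "p \<in> Hom C X E"
    and D: "brick C D" and E: "brick C E"
    and DE: "\<not> maps_to D E" and ED: "\<not> maps_to E D"
    and ns: "\<not> (\<exists>s \<in> Hom C E X. p \<cdot> s = Id C E)"
  shows "brick C X"
proof (rule brickI)
  have o: "D \<in> Obj C" "X \<in> Obj C" "E \<in> Obj C" using S Hom_Obj by auto
  have nr: "\<not> (\<exists>r \<in> Hom C X D. r \<cdot> i = Id C D)" using short_exact_split[OF S] ns by blast
  show "X \<in> Obj C" by (rule o)
  show "\<not> is_zero_obj C X"
    using mono_zero_dom[OF S(2) short_exact_mono[OF S(1)]] zero_obj_hom(2)[OF _ S(2)] D brick_iff by blast
  fix g assume g: "g \<in> Hom C X X" "g \<noteq> Hzero C X X"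
  note gi = Comp_closed[OF S(2) g(1)] and pg = Comp_closed[OF g(1) S(3)]
  have pgi: "p \<cdot> (g \<cdot> i) = Hzero C D E"
    using DE Comp_closed[OF gi S(3)] unfolding maps_to_def by blast
  then obtain g1 where g1: "g1 \<in> Hom C D D" "i \<cdot> g1 = g \<cdot> i" using short_exact_lift[OF S gi] by blast
  have "(p \<cdot> g) \<cdot> i = Hzero C D E" using pgi Comp_assoc[OF S(2) g(1) S(3)] by simp
  then obtain g2 where g2: "g2 \<in> Hom C E E" "g2 \<cdot> p = p \<cdot> g" using short_exact_factor[OF S pg] by blast
  have "g2 \<noteq> Hzero C E E"
  proof
    assume "g2 = Hzero C E E"
    then have "p \<cdot> g = Hzero C X E" using g2 comp_zero_left[OF S(3) o(3)] by simp
    then obtain t where t: "t \<in> Hom C X D" "i \<cdot> t = g" using short_exact_lift[OF S g(1)] by blast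
    note ti = Comp_closed[OF S(2) t(1)]
    have "t \<cdot> i = Hzero C D D"
    proof (rule ccontr)
      assume "t \<cdot> i \<noteq> Hzero C D D"
      then have "is_iso C (t \<cdot> i)" using D ti brick_iff by blast
      then obtain w where w: "w \<in> Hom C D D" "w \<cdot> (t \<cdot> i) = Id C D" using isoE ti by metis
      have "(w \<cdot> t) \<cdot> i = Id C D" using Comp_assoc[OF S(2) t(1) w(1)] w by simp
      then show False using nr Comp_closed[OF t(1) w(1)] by blast
    qed
    then obtain t' where t': "t' \<in> Hom C E D" "t' \<cdot> p = t" using short_exact_factor[OF S t(1)] by blast
    then have "t' = Hzero C E D" using ED unfolding maps_to_def by blast
    then have "t = Hzero C X D" using t' comp_zero_left[OF S(3) o(1)] by simp
    then show False using t g comp_zero_right[OF S(2) o(2)] by simp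
  qed
  then have i2: "is_iso C g2" using E g2 brick_iff by blast
  then obtain w where w: "w \<in> Hom C E E" "g2 \<cdot> w = Id C E" using isoE g2 by metis
  have "g1 \<noteq> Hzero C D D"
  proof
    assume "g1 = Hzero C D D"
    then have "g \<cdot> i = Hzero C D X" using g1 comp_zero_right[OF S(2) o(1)] by simp
    then obtain s where s: "s \<in> Hom C E X" "s \<cdot> p = g" using short_exact_factor[OF S g(1)] by blast
    have "(p \<cdot> s) \<cdot> p = g2 \<cdot> p" using Comp_assoc[OF S(3) s(1) S(3)] s g2 by simp
    then have "p \<cdot> s = g2"
      using epiD[OF short_exact_epi[OF S(1)] S(3) Comp_closed[OF s(1) S(3)] g2(1)] by blast
    then have "p \<cdot> (s \<cdot> w) = Id C E" using Comp_assoc[OF w(1) s(1) S(3)] w by simp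
    then show False using ns Comp_closed[OF w(1) s(1)] by blast
  qed
  then have i1: "is_iso C g1" using D g1 brick_iff by blast
  show "is_mono C g"
  proof (rule mono_zeroI[OF g(1)])
    fix W x assume x: "x \<in> Hom C W X" "g \<cdot> x = Hzero C W X"
    have W: "W \<in> Obj C" using x Hom_Obj by blast
    have "g2 \<cdot> (p \<cdot> x) = p \<cdot> (g \<cdot> x)"
      using Comp_assoc[OF x(1) S(3) g2(1)] Comp_assoc[OF x(1) g(1) S(3)] g2(2) by simp
    then have "g2 \<cdot> (p \<cdot> x) = Hzero C W E" using x(2) comp_zero_right[OF S(3) W] by simp
    then have "p \<cdot> x = Hzero C W E"
      using mono_zeroD[OF iso_mono[OF i2] g2(1) Comp_closed[OF x(1) S(3)]] by blast
    then obtain y where y: "y \<in> Hom C W D" "i \<cdot> y = x" using short_exact_lift[OF S x(1)] by blast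
    have "(i \<cdot> g1) \<cdot> y = Hzero C W X"
      using g1(2) Comp_assoc[OF y(1) S(2) g(1)] y(2) x(2) by simp
    moreover have "is_mono C (i \<cdot> g1)" using mono_comp[OF iso_mono[OF i1] short_exact_mono[OF S(1)] g1(1) S(2)] .
    ultimately have "y = Hzero C W D"
      using mono_zeroD[OF _ Comp_closed[OF g1(1) S(2)] y(1)] by blast
    then show "x = Hzero C W X" using y(2) comp_zero_right[OF S(2) W] by simp
  qed
qed

text \<open>
  This is the kernel of the map from \<open>B\<close> to the direct sum of the \<open>Y k\<close>, described without forming
  the sum.
\<close>
definition joint_kernel where
  "joint_kernel f Y F B K \<kappa> \<longleftrightarrow> \<kappa> \<in> Hom C K B \<and> is_mono C \<kappa> \<and>
    (\<forall>k\<in>F. f k \<cdot> \<kappa> = Hzero C K (Y k)) \<and>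
    (\<forall>W. \<forall>h \<in> Hom C W B. (\<forall>k\<in>F. f k \<cdot> h = Hzero C W (Y k)) \<longrightarrow> (\<exists>u \<in> Hom C W K. \<kappa> \<cdot> u = h))"

lemma joint_kernel_lift:
  assumes J: "joint_kernel f Y F B K \<kappa>" and h: "h \<in> Hom C W B"
    and v: "\<And>k. k \<in> F \<Longrightarrow> f k \<cdot> h = Hzero C W (Y k)"
  obtains u where "u \<in> Hom C W K" "\<kappa> \<cdot> u = h"
proof -
  have "\<exists>u \<in> Hom C W K. \<kappa> \<cdot> u = h"
    using J[unfolded joint_kernel_def, THEN conjunct2, THEN conjunct2, THEN conjunct2] h v by simp
  then show ?thesis using that by blast
qed

lemma joint_kernel_exists:
  assumes "finite F" "\<And>k. k \<in> F \<Longrightarrow> f k \<in> Hom C B (Y k)" "B \<in> Obj C"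
  shows "\<exists>K \<kappa>. joint_kernel f Y F B K \<kappa>"
  using assms
proof (induction F)
  case empty
  have "is_iso C (Id C B)" using Id_iso empty by blast
  then have "joint_kernel f Y {} B B (Id C B)"
    unfolding joint_kernel_def using iso_mono Id_closed Comp_Id_left empty by auto
  then show ?case by blast
next
  case (insert n F)
  then obtain K \<kappa> where J: "joint_kernel f Y F B K \<kappa>" by blast
  then have k: "\<kappa> \<in> Hom C K B" "is_mono C \<kappa>" unfolding joint_kernel_def by auto
  have fn: "f n \<in> Hom C B (Y n)" using insert by blast
  note fk = Comp_closed[OF k(1) fn]
  obtain K' \<iota> where i: "\<iota> \<in> Hom C K' K" "is_kernel C (f n \<cdot> \<kappa>) \<iota>" "is_mono C \<iota>"
    using kernel_obtain[OF fk] .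
  have K': "K' \<in> Obj C" using i Hom_Obj by blast
  have "joint_kernel f Y (insert n F) B K' (\<kappa> \<cdot> \<iota>)"
    unfolding joint_kernel_def
  proof (intro conjI ballI allI impI)
    show "\<kappa> \<cdot> \<iota> \<in> Hom C K' B" "is_mono C (\<kappa> \<cdot> \<iota>)"
      using Comp_closed[OF i(1) k(1)] mono_comp[OF i(3) k(2) i(1) k(1)] by auto
    fix l assume l: "l \<in> insert n F"
    then have fl: "f l \<in> Hom C B (Y l)" using insert by blast
    have "(f l \<cdot> \<kappa>) \<cdot> \<iota> = Hzero C K' (Y l)"
    proof (cases "l = n")
      case True
      then show ?thesis using kernel_comp[OF i(2) fk i(1)] by simp
    next
      case False
      then have "f l \<cdot> \<kappa> = Hzero C K (Y l)" using J l unfolding joint_kernel_def by blast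
      then show ?thesis using comp_zero_left[OF i(1)] Hom_Obj[OF fl] by simp
    qed
    then show "f l \<cdot> (\<kappa> \<cdot> \<iota>) = Hzero C K' (Y l)" using Comp_assoc[OF i(1) k(1) fl] by simp
  next
    fix W h assume h: "h \<in> Hom C W B" "\<forall>k\<in>insert n F. f k \<cdot> h = Hzero C W (Y k)"
    obtain u where u: "u \<in> Hom C W K" "\<kappa> \<cdot> u = h" using joint_kernel_lift[OF J h(1)] h(2) by auto
    have "(f n \<cdot> \<kappa>) \<cdot> u = Hzero C W (Y n)" using Comp_assoc[OF u(1) k(1) fn] u h by simp
    then obtain v where v: "v \<in> Hom C W K'" "\<iota> \<cdot> v = u" using kernel_lift[OF i(2) fk i(1) u(1)] by blast
    then show "\<exists>u\<in>Hom C W K'. (\<kappa> \<cdot> \<iota>) \<cdot> u = h" using Comp_assoc[OF v(1) i(1) k(1)] u(2) by auto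
  qed
  then show ?case by blast
qed

end

section \<open>Orthogonal families of bricks and critical objects\<close>

text \<open>
  The third assumption is the source of non-split extensions by members of the family: it
  provides the non-zero map \<open>S j \<rightarrow> S n / K\<close> along which an extension is pulled back below.
\<close>
locale orthogonal_bricks = abelian_length_category C
  for C :: "('o, 'm, 'z) preadd_cat_scheme" (structure) +
  fixes S :: "nat \<Rightarrow> 'o"
  assumes brick_S: "brick C (S k)"
    and orthogonal: "i \<noteq> j \<Longrightarrow> \<not> maps_to (S i) (S j)"
    and common_quotients: "\<lbrakk>e \<in> Hom C (S i) Q; is_epi C e; \<not> is_mono C e; \<not> is_zero_obj C Q\<rbrakk>
      \<Longrightarrow> maps_to (S j) Q"
begin

definition supp where "supp X = {k. maps_to X (S k)}"

text \<open>
  By the next two lemmas, the objects of finite support are closed under quotients and extensions,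
  that is, they form a torsion class.
\<close>
lemma supp_quotient: "e \<in> Hom C X Y \<Longrightarrow> is_epi C e \<Longrightarrow> supp Y \<subseteq> supp X"
  unfolding supp_def using maps_to_epi by blast

lemma supp_extension:
  assumes "short_exact i p" "i \<in> Hom C K X" "p \<in> Hom C X Q"
  shows "supp X \<subseteq> supp K \<union> supp Q"
proof
  fix k assume "k \<in> supp X"
  then obtain f where f: "f \<in> Hom C X (S k)" "f \<noteq> Hzero C X (S k)"
    unfolding supp_def maps_to_def by blast
  show "k \<in> supp K \<union> supp Q"
  proof (cases "f \<cdot> i = Hzero C K (S k)")
    case True
    obtain u where u: "u \<in> Hom C Q (S k)" "u \<cdot> p = f" using short_exact_factor[OF assms f(1) True] .
    have "u \<noteq> Hzero C Q (S k)" using u f comp_zero_left[OF assms(3)] Hom_Obj by metis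
    then show ?thesis using u unfolding supp_def maps_to_def by blast
  next
    case False
    then show ?thesis using Comp_closed[OF assms(2) f(1)] unfolding supp_def maps_to_def by blast
  qed
qed

lemma finite_supp_S: "finite (supp (S j))"
proof -
  have "k = j" if "k \<in> supp (S j)" for k
    using that orthogonal[of j k] unfolding supp_def by auto
  then have "supp (S j) \<subseteq> {j}" by auto
  then show ?thesis by (rule finite_subset) simp
qed

lemma infinite_supp_nonzero:
  assumes "infinite (supp X)" shows "\<not> is_zero_obj C X"
proof
  assume "is_zero_obj C X"
  then have "supp X = {}" unfolding supp_def maps_to_def using zero_obj_hom(1) by blast
  then show False using assms by simp
qed

text \<open>
  Minimal objects outside the torsion class of objects of finite support: an epimorphism that is
  not mono is a projection to a proper quotient, and those have finite support.
\<close>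
definition critical where
  "critical B \<longleftrightarrow> B \<in> Obj C \<and> infinite (supp B) \<and>
    (\<forall>Q. \<forall>e \<in> Hom C B Q. is_epi C e \<longrightarrow> infinite (supp Q) \<longrightarrow> is_mono C e)"

text \<open>
  If \<open>I\<close> is the image of a non-zero map, then \<open>I\<close> has finite support as a quotient of \<open>Z\<close>, and
  \<open>B / I\<close> has finite support because it is a proper quotient; so \<open>B\<close> would have finite support.
\<close>
lemma critical_no_map:
  assumes B: "critical B" and Z: "finite (supp Z)"
  shows "\<not> maps_to Z B"
proof
  assume "maps_to Z B"
  then obtain f where f: "f \<in> Hom C Z B" "f \<noteq> Hzero C Z B" unfolding maps_to_def by blast
  obtain I e m where em: "e \<in> Hom C Z I" "m \<in> Hom C I B" "is_epi C e" "is_mono C m"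
    "\<not> is_zero_obj C I" using nonzero_image[OF f] by metis
  obtain R q where q: "q \<in> Hom C B R" "short_exact m q" using mono_short_exact[OF em(4,2)] .
  have "\<not> is_mono C q" using short_exact_mono_zero[OF q(2) em(2) q(1)] em(5) by blast
  then have "finite (supp R)" using B q short_exact_epi unfolding critical_def by blast
  moreover have "finite (supp I)" using supp_quotient[OF em(1,3)] Z finite_subset by blast
  ultimately have "finite (supp B)" using supp_extension[OF q(2) em(2) q(1)] finite_subset by blast
  then show False using B unfolding critical_def by blast
qed

text \<open>
  The image is not of finite support, as it is a non-zero subobject of the critical object \<open>B'\<close>. Hence it is
  not a proper quotient of \<open>B\<close>.
\<close>
lemma critical_map_mono:
  assumes B: "critical B" "critical B'" and f: "f \<in> Hom C B B'" "f \<noteq> Hzero C B B'"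
  shows "is_mono C f"
proof -
  obtain I e m where em: "e \<in> Hom C B I" "m \<in> Hom C I B'" "is_epi C e" "is_mono C m" "f = m \<cdot> e"
    "m \<noteq> Hzero C I B'" using nonzero_image[OF f] by metis
  then have "infinite (supp I)" using critical_no_map[OF B(2)] unfolding maps_to_def by blast
  then have "is_mono C e" using B(1) em unfolding critical_def by blast
  then show ?thesis using mono_comp em by blast
qed

lemma critical_brick: "critical B \<Longrightarrow> brick C B"
  using brickI critical_map_mono infinite_supp_nonzero unfolding critical_def by blast

lemma critical_quotient:
  assumes "X \<in> Obj C" "infinite (supp X)"
  obtains B e where "critical B" "e \<in> Hom C X B" "is_epi C e"
proof -
  define P where "P D \<longleftrightarrow> infinite (supp D) \<and> (\<exists>e \<in> Hom C X D. is_epi C e)" for D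
  have "is_iso C (Id C X)" using Id_iso assms by blast
  then have "P X" unfolding P_def using Id_closed iso_epi assms by blast
  then obtain B where B: "P B" "\<And>D'. P D' \<Longrightarrow> obj_length C B \<le> obj_length C D'"
    using ex_has_least_nat[of P X "obj_length C"] by blast
  obtain e where e: "e \<in> Hom C X B" "is_epi C e" using B(1) unfolding P_def by blast
  have "critical B" unfolding critical_def
  proof (intro conjI allI ballI impI)
    show "B \<in> Obj C" "infinite (supp B)" using e Hom_Obj B(1) unfolding P_def by auto
    fix Q d assume d: "d \<in> Hom C B Q" "is_epi C d" "infinite (supp Q)"
    then have "P Q" unfolding P_def using epi_comp[OF e(2) d(2) e(1) d(1)] Comp_closed[OF e(1) d(1)] by blast
    then show "is_mono C d" using length_epi(2)[OF d(1,2)] B(2) iso_mono by blast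
  qed
  then show ?thesis using that e by blast
qed

text \<open>
  Take a critical quotient \<open>B'\<close> of \<open>X\<close>. The composite \<open>B \<rightarrow> X \<rightarrow> B'\<close> is non-zero, since otherwise \<open>B'\<close>
  would be a quotient of \<open>Z\<close>; so it is mono, and by maximality of the length of \<open>B\<close> it is
  invertible.
\<close>
lemma longest_critical_splits:
  assumes B: "critical B" and max: "\<And>B'. critical B' \<Longrightarrow> obj_length C B' \<le> obj_length C B"
    and X: "short_exact i p" "i \<in> Hom C B X" "p \<in> Hom C X Z" and Z: "finite (supp Z)" and inf: "infinite (supp X)"
  shows "\<exists>r \<in> Hom C X B. r \<cdot> i = Id C B"
proof -
  have "X \<in> Obj C" using X Hom_Obj by blast
  then obtain B' e where e: "critical B'" "e \<in> Hom C X B'" "is_epi C e"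
    using critical_quotient inf by blast
  note ei = Comp_closed[OF X(2) e(2)]
  have "e \<cdot> i \<noteq> Hzero C B B'"
  proof
    assume "e \<cdot> i = Hzero C B B'"
    then obtain h where h: "h \<in> Hom C Z B'" "h \<cdot> p = e" using short_exact_factor[OF X e(2)] by blast
    then have "h = Hzero C Z B'" using critical_no_map[OF e(1) Z] unfolding maps_to_def by blast
    then have "e = Hzero C X B'" using h comp_zero_left[OF X(3)] Hom_Obj by metis
    then have "is_zero_obj C B'" using epi_zero_cod e by blast
    then show False using e(1) infinite_supp_nonzero unfolding critical_def by blast
  qed
  then have "is_mono C (e \<cdot> i)" using critical_map_mono[OF B e(1) ei] by blast
  then have "is_iso C (e \<cdot> i)" using length_mono(2)[OF ei] max[OF e(1)] by blast
  then obtain g where g: "g \<in> Hom C B' B" "g \<cdot> (e \<cdot> i) = Id C B" using isoE ei by metis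
  have "(g \<cdot> e) \<cdot> i = Id C B" using Comp_assoc[OF X(2) e(2) g(1)] g by simp
  then show ?thesis using Comp_closed[OF e(2) g(1)] by blast
qed

text \<open>
  Each \<open>S k\<close> has a simple subobject, so one of the finitely many simple objects embeds into
  infinitely many of them.
\<close>
lemma infinite_supp_exists:
  assumes R: "finite R" "\<And>T. simple_obj C T \<Longrightarrow> \<exists>T'\<in>R. (T, T') \<in> iso_rel C"
  shows "\<exists>T. T \<in> Obj C \<and> infinite (supp T)"
proof -
  have "\<exists>T\<in>R. T \<in> Obj C \<and> maps_to T (S k)" for k
  proof -
    have Sk: "S k \<in> Obj C" "\<not> is_zero_obj C (S k)" using brick_S brick_iff by auto
    obtain T m where T: "simple_obj C T" "m \<in> Hom C T (S k)" "is_mono C m"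
      using simple_subobject[OF Sk] .
    have "m \<noteq> Hzero C T (S k)" using mono_zero_dom[OF T(2,3)] T(1) unfolding simple_obj_def by blast
    then have "maps_to T (S k)" unfolding maps_to_def using T by blast
    moreover obtain T' where "T' \<in> R" "(T, T') \<in> iso_rel C" using R(2) T(1) by blast
    ultimately show ?thesis using maps_to_iso_dom unfolding iso_rel_def by blast
  qed
  then obtain t where t: "\<And>k. t k \<in> R" "\<And>k. t k \<in> Obj C" "\<And>k. maps_to (t k) (S k)" by metis
  have "range t \<subseteq> R" using t(1) by blast
  then have "finite (range t)" using R(1) by (rule finite_subset)
  then obtain k where "infinite {l \<in> UNIV. t l = t k}" using pigeonhole_infinite[of UNIV t] by auto
  moreover have "{l \<in> UNIV. t l = t k} \<subseteq> supp (t k)"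
  proof
    fix l assume "l \<in> {l \<in> UNIV. t l = t k}"
    then show "l \<in> supp (t k)" using t(3)[of l] unfolding supp_def by simp
  qed
  ultimately have "infinite (supp (t k))" using finite_subset by blast
  then show ?thesis using t(2) by blast
qed

text \<open>
  Take a shortest object \<open>K\<close> among the joint kernels of finite families. All \<open>f k\<close> vanish on \<open>K\<close>,
  because otherwise adding one more would shorten it. So they all factor through \<open>B / K\<close>, which
  therefore has infinite support and cannot be a proper quotient of the critical object \<open>B\<close>.
\<close>
lemma critical_jointly_mono:
  assumes B: "critical B" and f: "\<And>k. k \<in> supp B \<Longrightarrow> f k \<in> Hom C B (S k) \<and> f k \<noteq> Hzero C B (S k)"
  shows "\<exists>F. finite F \<and> F \<subseteq> supp B \<and>
    (\<forall>W. \<forall>x\<in>Hom C W B. (\<forall>k\<in>F. f k \<cdot> x = Hzero C W (S k)) \<longrightarrow> x = Hzero C W B)"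
proof -
  have oB: "B \<in> Obj C" using B unfolding critical_def by blast
  have ex: "\<exists>K \<kappa>. joint_kernel f S F B K \<kappa>" if "finite F" "F \<subseteq> supp B" for F
    using joint_kernel_exists[OF that(1) _ oB] f that by blast
  define P where "P K \<longleftrightarrow> (\<exists>F \<kappa>. finite F \<and> F \<subseteq> supp B \<and> joint_kernel f S F B K \<kappa>)" for K
  have "\<exists>K. P K" unfolding P_def using ex[of "{}"] by blast
  then obtain K where K: "P K" "\<And>K'. P K' \<Longrightarrow> obj_length C K \<le> obj_length C K'"
    using ex_has_least_nat[of P _ "obj_length C"] by metis
  obtain F \<kappa> where F: "finite F" "F \<subseteq> supp B" and J: "joint_kernel f S F B K \<kappa>"
    using K(1) unfolding P_def by blast
  have k: "\<kappa> \<in> Hom C K B" "is_mono C \<kappa>" using J unfolding joint_kernel_def by auto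
  have van: "f n \<cdot> \<kappa> = Hzero C K (S n)" if n: "n \<in> supp B" for n
  proof -
    have fn: "f n \<in> Hom C B (S n)" using f n by blast
    obtain K' \<kappa>' where J': "joint_kernel f S (insert n F) B K' \<kappa>'" using ex[of "insert n F"] F n by auto
    then have k': "\<kappa>' \<in> Hom C K' B" "is_mono C \<kappa>'" "f n \<cdot> \<kappa>' = Hzero C K' (S n)"
      "\<forall>k\<in>F. f k \<cdot> \<kappa>' = Hzero C K' (S k)"
      unfolding joint_kernel_def by auto
    obtain v where v: "v \<in> Hom C K' K" "\<kappa> \<cdot> v = \<kappa>'" using joint_kernel_lift[OF J k'(1)] k'(4) by auto
    have "is_mono C v" using mono_cancel[OF v(1) k(1)] v(2) k'(2) by simp
    moreover have "P K'" unfolding P_def using J' F n by blast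
    ultimately have "is_iso C v" using length_mono(2)[OF v(1)] K(2) by blast
    moreover have "(f n \<cdot> \<kappa>) \<cdot> v = Hzero C K' (S n)" using Comp_assoc[OF v(1) k(1) fn] v(2) k'(3) by simp
    ultimately show ?thesis using epi_zeroD[OF iso_epi v(1) Comp_closed[OF k(1) fn]] by blast
  qed
  obtain M c where c: "c \<in> Hom C B M" "short_exact \<kappa> c" using mono_short_exact[OF k(2,1)] .
  have "supp B \<subseteq> supp M"
  proof
    fix n assume n: "n \<in> supp B"
    then have fn: "f n \<in> Hom C B (S n)" "f n \<noteq> Hzero C B (S n)" using f by auto
    obtain u where u: "u \<in> Hom C M (S n)" "u \<cdot> c = f n" using short_exact_factor[OF c(2) k(1) c(1) fn(1) van[OF n]] .
    have "u \<noteq> Hzero C M (S n)" using u fn comp_zero_left[OF c(1)] Hom_Obj by metis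
    then show "n \<in> supp M" unfolding supp_def maps_to_def using u by blast
  qed
  then have "infinite (supp M)" using B finite_subset unfolding critical_def by blast
  then have "is_mono C c" using B c short_exact_epi unfolding critical_def by blast
  then have K0: "is_zero_obj C K" using short_exact_mono_zero[OF c(2) k(1) c(1)] by blast
  have "x = Hzero C W B" if x: "x \<in> Hom C W B" "\<forall>k\<in>F. f k \<cdot> x = Hzero C W (S k)" for W x
  proof -
    obtain u where u: "u \<in> Hom C W K" "\<kappa> \<cdot> u = x" using joint_kernel_lift[OF J x(1)] x(2) by auto
    have "W \<in> Obj C" using u Hom_Obj by blast
    then show ?thesis using zero_obj_hom(2)[OF K0 u(1)] comp_zero_right[OF k(1)] u(2) by simp
  qed
  then show ?thesis using F by (intro exI[of _ F]) simp
qed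

text \<open>
  Let \<open>F\<close> be a jointly monic family of least size, \<open>n \<in> F\<close>, and \<open>K\<close> the joint kernel of the others.
  Then \<open>K\<close> is a non-zero subobject of \<open>S n\<close>, and a proper one since \<open>S n\<close> does not map to \<open>B\<close>. So
  some \<open>S j\<close> with \<open>j \<notin> F\<close> has a non-zero map \<open>g\<close> to \<open>Q = S n / K\<close>. The sequence
  \<open>K \<rightarrow> S n \<rightarrow> Q\<close> is pulled back along \<open>g\<close> to \<open>K \<rightarrow> P \<rightarrow> S j\<close>, and then pushed out along \<open>K \<rightarrow> B\<close>.

  A splitting of the result would be an extension \<open>t : P \<rightarrow> B\<close> of \<open>K \<rightarrow> B\<close>. By orthogonality a map
  from \<open>P\<close> to \<open>S l\<close> with \<open>l \<noteq> j\<close> is determined by its restriction to \<open>K\<close>. This forces \<open>t\<close> to take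
  values in \<open>K\<close>, and \<open>P \<rightarrow> S n\<close> to do so as well, so that \<open>g\<close> would be zero.
\<close>
lemma critical_nonsplit_extension:
  assumes B: "critical B"
  obtains j X i q where "short_exact i q" "i \<in> Hom C B X" "q \<in> Hom C X (S j)"
    "\<not> (\<exists>r \<in> Hom C X B. r \<cdot> i = Id C B)"
proof -
  have oB: "B \<in> Obj C" "\<not> is_zero_obj C B" using B infinite_supp_nonzero unfolding critical_def by auto
  have "\<forall>k\<in>supp B. \<exists>f. f \<in> Hom C B (S k) \<and> f \<noteq> Hzero C B (S k)"
    unfolding supp_def maps_to_def by blast
  then obtain f where f: "\<And>k. k \<in> supp B \<Longrightarrow> f k \<in> Hom C B (S k) \<and> f k \<noteq> Hzero C B (S k)"
    using bchoice[of "supp B" "\<lambda>k f. f \<in> Hom C B (S k) \<and> f \<noteq> Hzero C B (S k)"] by auto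
  define P where "P F \<longleftrightarrow> finite F \<and> F \<subseteq> supp B \<and>
    (\<forall>W. \<forall>x\<in>Hom C W B. (\<forall>k\<in>F. f k \<cdot> x = Hzero C W (S k)) \<longrightarrow> x = Hzero C W B)" for F
  have "\<exists>F. P F" unfolding P_def using critical_jointly_mono[OF B f] by blast
  then obtain F where F: "P F" "\<And>F'. P F' \<Longrightarrow> card F \<le> card F'"
    using ex_has_least_nat[of P _ card] by metis
  have fF: "finite F" "F \<subseteq> supp B" using F(1) unfolding P_def by auto
  have "F \<noteq> {}"
  proof
    assume "F = {}"
    then have "Id C B = Hzero C B B" using F(1) Id_closed[OF oB(1)] unfolding P_def by blast
    then show False using oB zero_obj_iff by blast
  qed
  then obtain n where n: "n \<in> F" by blast
  let ?F = "F - {n}"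
  have fk: "f k \<in> Hom C B (S k)" if "k \<in> F" for k using f fF that by blast
  obtain K \<kappa> where J: "joint_kernel f S ?F B K \<kappa>"
    using joint_kernel_exists[of ?F f B S] fF fk oB by auto
  then have k: "\<kappa> \<in> Hom C K B" "is_mono C \<kappa>" "\<And>k. k \<in> ?F \<Longrightarrow> f k \<cdot> \<kappa> = Hzero C K (S k)"
    unfolding joint_kernel_def by auto
  have K0: "\<not> is_zero_obj C K"
  proof
    assume K0: "is_zero_obj C K"
    have "P ?F" unfolding P_def
    proof (intro conjI allI ballI impI)
      show "finite ?F" "?F \<subseteq> supp B" using fF by auto
      fix W x assume x: "x \<in> Hom C W B" "\<forall>k\<in>?F. f k \<cdot> x = Hzero C W (S k)"
      then obtain u where u: "u \<in> Hom C W K" "\<kappa> \<cdot> u = x" using joint_kernel_lift[OF J x(1)] by auto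
      have "W \<in> Obj C" using u Hom_Obj by blast
      then show "x = Hzero C W B" using zero_obj_hom(2)[OF K0 u(1)] comp_zero_right[OF k(1)] u(2) by simp
    qed
    then have "card F \<le> card ?F" by (rule F(2))
    then show False using n fF(1) by (metis card_Diff1_less not_le)
  qed
  note fn = fk[OF n]
  note fkn = Comp_closed[OF k(1) fn]
  have mono: "is_mono C (f n \<cdot> \<kappa>)"
  proof (rule mono_zeroI[OF fkn])
    fix W x assume x: "x \<in> Hom C W K" "(f n \<cdot> \<kappa>) \<cdot> x = Hzero C W (S n)"
    note kx = Comp_closed[OF x(1) k(1)]
    have "f l \<cdot> (\<kappa> \<cdot> x) = Hzero C W (S l)" if l: "l \<in> F" for l
    proof (cases "l = n")
      case True
      then show ?thesis using x(2) Comp_assoc[OF x(1) k(1) fn] by simp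
    next
      case False
      then have "f l \<cdot> \<kappa> = Hzero C K (S l)" using k(3) l by blast
      then show ?thesis
        using Comp_assoc[OF x(1) k(1) fk[OF l]] comp_zero_left[OF x(1)] Hom_Obj[OF fk[OF l]] by simp
    qed
    then have "\<kappa> \<cdot> x = Hzero C W B" using F(1) kx unfolding P_def by blast
    then show "x = Hzero C W K" using mono_zeroD[OF k(2,1) x(1)] by blast
  qed
  obtain Q c where c: "c \<in> Hom C (S n) Q" "short_exact (f n \<cdot> \<kappa>) c" using mono_short_exact[OF mono fkn] .
  have cm: "\<not> is_mono C c" using short_exact_mono_zero[OF c(2) fkn c(1)] K0 by blast
  have Q0: "\<not> is_zero_obj C Q"
  proof
    assume "is_zero_obj C Q"
    then have "is_iso C (f n \<cdot> \<kappa>)" using zero_cokernel_epi[OF c(2) fkn c(1)] mono mono_epi_iso by blast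
    then obtain g where g: "g \<in> Hom C (S n) K" "g \<cdot> (f n \<cdot> \<kappa>) = Id C K" using isoE fkn by metis
    have "\<kappa> \<cdot> g = Hzero C (S n) B"
      using critical_no_map[OF B finite_supp_S] Comp_closed[OF g(1) k(1)] unfolding maps_to_def by blast
    then have "(\<kappa> \<cdot> g) \<cdot> (f n \<cdot> \<kappa>) = Hzero C K B" using comp_zero_left[OF fkn oB(1)] by simp
    then have "\<kappa> = Hzero C K B" using Comp_assoc[OF fkn g(1) k(1)] g(2) Comp_Id_right[OF k(1)] by simp
    then show False using K0 mono_zero_dom[OF k(1,2)] by blast
  qed
  obtain j where j: "j \<notin> F" using ex_new_if_finite[OF infinite_UNIV_nat fF(1)] by blast
  obtain g where g: "g \<in> Hom C (S j) Q" "g \<noteq> Hzero C (S j) Q"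
    using common_quotients[OF c(1) short_exact_epi[OF c(2)] cm Q0, of j] unfolding maps_to_def by blast
  obtain P u p h where P: "u \<in> Hom C K P" "p \<in> Hom C P (S j)" "h \<in> Hom C P (S n)"
    "short_exact u p" "h \<cdot> u = f n \<cdot> \<kappa>" "c \<cdot> h = g \<cdot> p"
    using short_exact_pullback[OF c(2) fkn c(1) g(1)] .
  obtain X i q v where X: "i \<in> Hom C B X" "q \<in> Hom C X (S j)" "v \<in> Hom C P X"
    "short_exact i q" "q \<cdot> v = p" "v \<cdot> u = i \<cdot> \<kappa>"
    using short_exact_pushout[OF P(4,1,2) k(1)] .
  have oP: "P \<in> Obj C" using P Hom_Obj by blast
  have "\<not> (\<exists>r \<in> Hom C X B. r \<cdot> i = Id C B)"
  proof
    assume "\<exists>r \<in> Hom C X B. r \<cdot> i = Id C B"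
    then obtain r where r: "r \<in> Hom C X B" "r \<cdot> i = Id C B" by blast
    define t where "t = r \<cdot> v"
    have t: "t \<in> Hom C P B" unfolding t_def using Comp_closed[OF X(3) r(1)] .
    have "t \<cdot> u = r \<cdot> (i \<cdot> \<kappa>)" unfolding t_def using Comp_assoc[OF P(1) X(3) r(1)] X(6) by simp
    then have tu: "t \<cdot> u = \<kappa>"
      using Comp_assoc[OF k(1) X(1) r(1)] r(2) Comp_Id_left[OF k(1)] by simp
    have orth: "y = Hzero C P (S l)" if y: "y \<in> Hom C P (S l)" "y \<cdot> u = Hzero C K (S l)" "l \<noteq> j" for y l
    proof -
      obtain w where w: "w \<in> Hom C (S j) (S l)" "w \<cdot> p = y" using short_exact_factor[OF P(4,1,2) y(1,2)] .
      then have "w = Hzero C (S j) (S l)" using orthogonal[of j l] y(3) unfolding maps_to_def by blast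
      then show ?thesis using w comp_zero_left[OF P(2)] Hom_Obj by metis
    qed
    have "f l \<cdot> t = Hzero C P (S l)" if l: "l \<in> ?F" for l
    proof (rule orth)
      have fl: "f l \<in> Hom C B (S l)" using fk l by blast
      show "f l \<cdot> t \<in> Hom C P (S l)" using Comp_closed[OF t fl] .
      show "(f l \<cdot> t) \<cdot> u = Hzero C K (S l)" using Comp_assoc[OF P(1) t fl] tu k(3)[OF l] by simp
      show "l \<noteq> j" using l j by blast
    qed
    then obtain t' where t': "t' \<in> Hom C P K" "\<kappa> \<cdot> t' = t" using joint_kernel_lift[OF J t] by blast
    note ft = Comp_closed[OF t fn]
    have "diff h (f n \<cdot> t) = Hzero C P (S n)"
    proof (rule orth)
      show "diff h (f n \<cdot> t) \<in> Hom C P (S n)" using diff_closed[OF P(3) ft] .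
      show "diff h (f n \<cdot> t) \<cdot> u = Hzero C K (S n)"
        using comp_diff_left[OF P(3) ft P(1)] Comp_assoc[OF P(1) t fn] tu P(5)
          diff_eq_zero[OF fkn fkn] by simp
      show "n \<noteq> j" using n j by blast
    qed
    then have "h = (f n \<cdot> \<kappa>) \<cdot> t'"
      using diff_eq_zero[OF P(3) ft] Comp_assoc[OF t'(1) k(1) fn] t'(2) by simp
    then have "c \<cdot> h = (c \<cdot> (f n \<cdot> \<kappa>)) \<cdot> t'" using Comp_assoc[OF t'(1) fkn c(1)] by simp
    also have "\<dots> = Hzero C P Q"
      using short_exact_comp[OF c(2) fkn c(1)] comp_zero_left[OF t'(1)] Hom_Obj[OF c(1)] by simp
    finally have "g \<cdot> p = Hzero C P Q" using P(6) by simp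
    then show False using epi_zeroD[OF short_exact_epi[OF P(4)] P(2) g(1)] g(2) by blast
  qed
  then show ?thesis using that X by blast
qed

text \<open>
  A brick \<open>E\<close> over \<open>S j\<close> is enlarged by pulling back one of the given extensions along \<open>q : E \<rightarrow> S j\<close>.
  The new extension is non-split as long as \<open>q\<close> does not lift to \<open>Z k\<close>. This non-lifting property
  is preserved for all unused indices: a lift from the enlarged brick would restrict to a map from
  \<open>S k\<close> to another \<open>S l\<close>, which is zero, and so would come from a lift of \<open>q\<close>.
\<close>
lemma long_bricks:
  assumes N: "infinite N" "j \<notin> N"
    and ext: "\<And>k. k \<in> N \<Longrightarrow> \<exists>Z i p. short_exact i p \<and> i \<in> Hom C (S k) Z \<and> p \<in> Hom C Z (S j) \<and>
      \<not> (\<exists>s \<in> Hom C (S j) Z. p \<cdot> s = Id C (S j))"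
  shows "\<exists>E. brick C E \<and> m \<le> obj_length C E"
proof -
  obtain Z i p where Z: "\<And>k. k \<in> N \<Longrightarrow> short_exact (i k) (p k)" "\<And>k. k \<in> N \<Longrightarrow> i k \<in> Hom C (S k) (Z k)"
    "\<And>k. k \<in> N \<Longrightarrow> p k \<in> Hom C (Z k) (S j)"
    "\<And>k. k \<in> N \<Longrightarrow> \<not> (\<exists>s \<in> Hom C (S j) (Z k). p k \<cdot> s = Id C (S j))"
    using ext by metis
  have "\<exists>E q G. finite G \<and> brick C E \<and> m \<le> obj_length C E \<and> q \<in> Hom C E (S j) \<and>
    (\<forall>l \<in> N - G. \<not> maps_to E (S l) \<and> \<not> maps_to (S l) E \<and> \<not> (\<exists>h \<in> Hom C E (Z l). p l \<cdot> h = q))"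
  proof (induction m)
    case 0
    have Sj: "S j \<in> Obj C" using brick_S brick_iff by blast
    have "\<not> maps_to (S j) (S l) \<and> \<not> maps_to (S l) (S j)
        \<and> \<not> (\<exists>h \<in> Hom C (S j) (Z l). p l \<cdot> h = Id C (S j))" if "l \<in> N - {}" for l
    proof -
      have "l \<in> N" "j \<noteq> l" "l \<noteq> j" using that N(2) by auto
      then show ?thesis using orthogonal Z(4) by blast
    qed
    then show ?case
      using brick_S[of j] Id_closed[OF Sj]
      by (intro exI[of _ "S j"] exI[of _ "Id C (S j)"] exI[of _ "{}"]) simp
  next
    case (Suc m)
    then obtain E q G where E: "finite G" "brick C E" "m \<le> obj_length C E" "q \<in> Hom C E (S j)"
      and G: "\<And>l. l \<in> N - G \<Longrightarrow> \<not> maps_to E (S l)" "\<And>l. l \<in> N - G \<Longrightarrow> \<not> maps_to (S l) E"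
        "\<And>l. l \<in> N - G \<Longrightarrow> \<not> (\<exists>h \<in> Hom C E (Z l). p l \<cdot> h = q)"
      by metis
    have "infinite (N - G)" using N(1) E(1) by simp
    then obtain k where k: "k \<in> N - G" using not_finite_existsD by (metis infinite_imp_nonempty ex_in_conv)
    then have kN: "k \<in> N" by blast
    obtain E' u e h where E': "u \<in> Hom C (S k) E'" "e \<in> Hom C E' E" "h \<in> Hom C E' (Z k)"
      "short_exact u e" "h \<cdot> u = i k" "p k \<cdot> h = q \<cdot> e"
      using short_exact_pullback[OF Z(1,2,3)[OF kN] E(4)] .
    note qe = Comp_closed[OF E'(2) E(4)]
    have ns: "\<not> (\<exists>s \<in> Hom C E E'. e \<cdot> s = Id C E)"
    proof
      assume "\<exists>s \<in> Hom C E E'. e \<cdot> s = Id C E"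
      then obtain s where s: "s \<in> Hom C E E'" "e \<cdot> s = Id C E" by blast
      have "p k \<cdot> (h \<cdot> s) = (q \<cdot> e) \<cdot> s" using Comp_assoc[OF s(1) E'(3) Z(3)[OF kN]] E'(6) by simp
      also have "\<dots> = q" using Comp_assoc[OF s(1) E'(2) E(4)] s(2) Comp_Id_right[OF E(4)] by simp
      finally show False using G(3)[OF k] Comp_closed[OF s(1) E'(3)] by blast
    qed
    have br: "brick C E'"
      using nonsplit_extension_brick[OF E'(4,1,2) brick_S E(2) G(2)[OF k] G(1)[OF k] ns] .
    have "\<not> is_mono C e"
      using short_exact_mono_zero[OF E'(4,1,2)] brick_S[of k] brick_iff by blast
    then have "\<not> obj_length C E' \<le> obj_length C E"
      using length_epi(2)[OF E'(2) short_exact_epi[OF E'(4)]] iso_mono by blast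
    then have "Suc m \<le> obj_length C E'" using E(3) by simp
    moreover have "\<not> maps_to E' (S l) \<and> \<not> maps_to (S l) E' \<and> \<not> (\<exists>x \<in> Hom C E' (Z l). p l \<cdot> x = q \<cdot> e)"
      if l: "l \<in> N - insert k G" for l
    proof (intro conjI)
      have lG: "l \<in> N - G" "l \<in> N" "l \<noteq> k" using l by auto
      have "l \<notin> supp (S k)" "l \<notin> supp E" using orthogonal lG G(1)[OF lG(1)] unfolding supp_def by auto
      then show "\<not> maps_to E' (S l)" using supp_extension[OF E'(4,1,2)] unfolding supp_def by blast
      show "\<not> maps_to (S l) E'"
      proof
        assume "maps_to (S l) E'"
        then obtain y where y: "y \<in> Hom C (S l) E'" "y \<noteq> Hzero C (S l) E'" unfolding maps_to_def by blast
        have "e \<cdot> y = Hzero C (S l) E"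
          using G(2)[OF lG(1)] Comp_closed[OF y(1) E'(2)] unfolding maps_to_def by blast
        then obtain w where w: "w \<in> Hom C (S l) (S k)" "u \<cdot> w = y" using short_exact_lift[OF E'(4,1,2) y(1)] by blast
        then have "w = Hzero C (S l) (S k)" using orthogonal[OF lG(3)] unfolding maps_to_def by blast
        then show False using w y comp_zero_right[OF E'(1)] Hom_Obj by metis
      qed
      show "\<not> (\<exists>x \<in> Hom C E' (Z l). p l \<cdot> x = q \<cdot> e)"
      proof
        assume "\<exists>x \<in> Hom C E' (Z l). p l \<cdot> x = q \<cdot> e"
        then obtain x where x: "x \<in> Hom C E' (Z l)" "p l \<cdot> x = q \<cdot> e" by blast
        note Zl = Z(1,2,3)[OF lG(2)]
        have o: "S k \<in> Obj C" "S j \<in> Obj C" "Z l \<in> Obj C" using brick_S brick_iff x Hom_Obj by auto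
        note xu = Comp_closed[OF E'(1) x(1)]
        have "p l \<cdot> (x \<cdot> u) = q \<cdot> (e \<cdot> u)"
          using Comp_assoc[OF E'(1) x(1) Zl(3)] x(2) Comp_assoc[OF E'(1,2) E(4)] by simp
        also have "\<dots> = Hzero C (S k) (S j)"
          using short_exact_comp[OF E'(4,1,2)] comp_zero_right[OF E(4) o(1)] by simp
        finally obtain w where w: "w \<in> Hom C (S k) (S l)" "i l \<cdot> w = x \<cdot> u" using short_exact_lift[OF Zl xu] by blast
        then have "w = Hzero C (S k) (S l)" using orthogonal[of k l] lG(3) unfolding maps_to_def by blast
        then have "x \<cdot> u = Hzero C (S k) (Z l)" using w comp_zero_right[OF Zl(2) o(1)] by simp
        then obtain x' where x': "x' \<in> Hom C E (Z l)" "x' \<cdot> e = x" using short_exact_factor[OF E'(4,1,2) x(1)] by blast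
        have "(p l \<cdot> x') \<cdot> e = q \<cdot> e" using Comp_assoc[OF E'(2) x'(1) Zl(3)] x'(2) x(2) by simp
        then have "p l \<cdot> x' = q"
          using epiD[OF short_exact_epi[OF E'(4)] E'(2) Comp_closed[OF x'(1) Zl(3)] E(4)] by blast
        then show False using G(3)[OF lG(1)] x'(1) by blast
      qed
    qed
    ultimately show ?case using br qe E(1) by (intro exI[of _ E'] exI[of _ "q \<cdot> e"] exI[of _ "insert k G"]) auto
  qed
  then show ?thesis by blast
qed

text \<open>
  A longest critical object \<open>B\<close> has a non-split extension \<open>X\<close> by some \<open>S j\<close>, which must have finite
  support. So for almost all \<open>k\<close> in the support of \<open>B\<close>, no non-zero map \<open>B \<rightarrow> S k\<close> extends to \<open>X\<close>, and
  pushing out along such a map yields one of the extensions needed for long bricks.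
\<close>
theorem unbounded_brick_lengths:
  assumes R: "finite R" "\<And>T. simple_obj C T \<Longrightarrow> \<exists>T'\<in>R. (T, T') \<in> iso_rel C"
  shows "\<exists>B. brick C B \<and> m \<le> obj_length C B"
proof (rule ccontr)
  assume "\<not> ?thesis"
  then have bound: "obj_length C B < m" if "brick C B" for B using that not_le by blast
  obtain T where "T \<in> Obj C" "infinite (supp T)" using infinite_supp_exists[OF R] by blast
  then obtain B0 where "critical B0" using critical_quotient by metis
  then obtain B where B: "critical B" "\<And>B'. critical B' \<Longrightarrow> obj_length C B' \<le> obj_length C B"
    using ex_has_greatest_nat[of critical B0 "obj_length C" m] bound critical_brick by (metis less_imp_le)
  obtain j X i q where X: "short_exact i q" "i \<in> Hom C B X" "q \<in> Hom C X (S j)"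
    "\<not> (\<exists>r \<in> Hom C X B. r \<cdot> i = Id C B)" using critical_nonsplit_extension[OF B(1)] .
  have fin: "finite (supp X)"
    using longest_critical_splits[OF B X(1-3) finite_supp_S] X(4) by blast
  let ?N = "supp B - supp X - {j}"
  have "infinite ?N" using B(1) fin unfolding critical_def by simp
  moreover have "\<exists>Z i p. short_exact i p \<and> i \<in> Hom C (S k) Z \<and> p \<in> Hom C Z (S j) \<and>
      \<not> (\<exists>s \<in> Hom C (S j) Z. p \<cdot> s = Id C (S j))" if k: "k \<in> ?N" for k
  proof -
    obtain f where f: "f \<in> Hom C B (S k)" "f \<noteq> Hzero C B (S k)"
      using k unfolding supp_def maps_to_def by blast
    obtain Z i' p v where Z: "i' \<in> Hom C (S k) Z" "p \<in> Hom C Z (S j)" "v \<in> Hom C X Z"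
      "short_exact i' p" "p \<cdot> v = q" "v \<cdot> i = i' \<cdot> f" using short_exact_pushout[OF X(1-3) f(1)] .
    have "\<not> (\<exists>r \<in> Hom C Z (S k). r \<cdot> i' = Id C (S k))"
    proof
      assume "\<exists>r \<in> Hom C Z (S k). r \<cdot> i' = Id C (S k)"
      then obtain r where r: "r \<in> Hom C Z (S k)" "r \<cdot> i' = Id C (S k)" by blast
      have "r \<cdot> v = Hzero C X (S k)"
        using k Comp_closed[OF Z(3) r(1)] unfolding supp_def maps_to_def by blast
      then have "(r \<cdot> v) \<cdot> i = Hzero C B (S k)" using comp_zero_left[OF X(2)] Hom_Obj[OF f(1)] by simp
      moreover have "(r \<cdot> v) \<cdot> i = f"
        using Comp_assoc[OF X(2) Z(3) r(1)] Z(6) Comp_assoc[OF f(1) Z(1) r(1)] r(2) Comp_Id_left[OF f(1)] by simp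
      ultimately show False using f(2) by simp
    qed
    then show ?thesis using short_exact_split[OF Z(4,1,2)] Z by blast
  qed
  ultimately obtain E where "brick C E" "m \<le> obj_length C E" using long_bricks[of ?N j m] by blast
  then show False using bound by fastforce
qed

end

context abelian_length_category begin

section \<open>Brick-finiteness and bounded length\<close>

lemma representatives:
  obtains R where "R \<subseteq> {X \<in> Obj C. P X}" "\<And>X. X \<in> Obj C \<Longrightarrow> P X \<Longrightarrow> \<exists>Y\<in>R. (X, Y) \<in> iso_rel C"
    "finite R \<longleftrightarrow> finite_up_to_iso C P" "\<And>X Y. X \<in> R \<Longrightarrow> Y \<in> R \<Longrightarrow> (X, Y) \<in> iso_rel C \<Longrightarrow> X = Y"
proof -
  let ?cl = "\<lambda>X. iso_rel C `` {X}" and ?A = "{X \<in> Obj C. P X}"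
  have cl: "?cl X = ?cl Y \<longleftrightarrow> (X, Y) \<in> iso_rel C" if "X \<in> Obj C" "Y \<in> Obj C" for X Y
    using eq_equiv_class_iff[OF iso_rel_equiv that] .
  obtain R where R: "R \<subseteq> ?A" "inj_on ?cl R" "?cl ` ?A = ?cl ` R"
    using subset_image_inj[of "?cl ` ?A" ?cl ?A] by auto
  have "?A // iso_rel C = ?cl ` ?A" by (auto simp: quotient_def)
  then have fin: "finite R \<longleftrightarrow> finite_up_to_iso C P"
    unfolding finite_up_to_iso_def using R(2,3) finite_image_iff by metis
  have ex: "\<exists>Y\<in>R. (X, Y) \<in> iso_rel C" if X: "X \<in> Obj C" "P X" for X
  proof -
    have "?cl X \<in> ?cl ` R" using X R(3) by blast
    then obtain Y where "Y \<in> R" "?cl X = ?cl Y" by blast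
    then show ?thesis using cl X R(1) by blast
  qed
  have uniq: "X = Y" if "X \<in> R" "Y \<in> R" "(X, Y) \<in> iso_rel C" for X Y
  proof -
    have "X \<in> Obj C" "Y \<in> Obj C" using that R(1) by auto
    then have "?cl X = ?cl Y" using cl that(3) by simp
    then show ?thesis using inj_onD[OF R(2)] that(1,2) by simp
  qed
  show ?thesis using that[OF R(1) ex fin uniq] .
qed

lemma brick_finite_bounded:
  assumes "brick_finite C" shows "\<exists>N. \<forall>B. brick C B \<longrightarrow> obj_length C B < N"
proof -
  obtain R where R: "R \<subseteq> {X \<in> Obj C. brick C X}"
    "\<And>X. X \<in> Obj C \<Longrightarrow> brick C X \<Longrightarrow> \<exists>Y\<in>R. (X, Y) \<in> iso_rel C"
    "finite R \<longleftrightarrow> finite_up_to_iso C (brick C)"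
    "\<And>X Y. X \<in> R \<Longrightarrow> Y \<in> R \<Longrightarrow> (X, Y) \<in> iso_rel C \<Longrightarrow> X = Y"
    by (rule representatives[of "brick C"], rule that)
  have fin: "finite (obj_length C ` R)" using R(3) assms unfolding brick_finite_def by simp
  have "obj_length C B < Suc (Max (obj_length C ` R))" if "brick C B" for B
  proof -
    have "B \<in> Obj C" using that by (simp add: brick_def)
    then obtain Y where "Y \<in> R" "(B, Y) \<in> iso_rel C" using R(2)[of B] \<open>brick C B\<close> by auto
    then have "obj_length C B \<in> obj_length C ` R" using length_iso[of B Y] by simp
    then show ?thesis using Max_ge[OF fin] by (simp add: le_imp_less_Suc)
  qed
  then show ?thesis by blast
qed

text \<open>
  The \<open>S k\<close> are non-isomorphic bricks of the least length \<open>r\<close> occurring infinitely often, chosen so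
  that the set \<open>\<tau>\<close> of shorter bricks to which they map is constant. A proper non-zero quotient \<open>Q\<close> of
  \<open>S i\<close> has a brick \<open>D\<close> as both quotient and subobject: \<open>S i\<close> maps to \<open>D\<close>, hence so does \<open>S j\<close>, and
  \<open>D\<close> lies in \<open>Q\<close>. If \<open>Q\<close> is the image of a map from \<open>S i\<close> to \<open>S j\<close>, then \<open>S j \<rightarrow> D \<rightarrow> S j\<close> is a non-zero
  endomorphism of the brick \<open>S j\<close> that is not invertible.
\<close>
lemma infinitely_many_bricks_orthogonal:
  assumes inf: "\<not> brick_finite C" and bound: "\<And>B. brick C B \<Longrightarrow> obj_length C B < N"
  shows "\<exists>S. orthogonal_bricks C S"
proof -
  obtain R where R: "R \<subseteq> {X \<in> Obj C. brick C X}"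
    "\<And>X. X \<in> Obj C \<Longrightarrow> brick C X \<Longrightarrow> \<exists>Y\<in>R. (X, Y) \<in> iso_rel C"
    "finite R \<longleftrightarrow> finite_up_to_iso C (brick C)"
    "\<And>X Y. X \<in> R \<Longrightarrow> Y \<in> R \<Longrightarrow> (X, Y) \<in> iso_rel C \<Longrightarrow> X = Y"
    by (rule representatives[of "brick C"], rule that)
  have infR: "infinite R" using R(3) inf unfolding brick_finite_def by simp
  define L where "L r = {X \<in> R. obj_length C X = r}" for r
  have "R \<subseteq> (\<Union>r<N. L r)" unfolding L_def using R(1) bound by auto
  then have "\<exists>r. infinite (L r)" using infR finite_subset by blast
  then obtain r where r: "infinite (L r)" "\<And>s. s < r \<Longrightarrow> finite (L s)"
    using exists_least_iff[of "\<lambda>r. infinite (L r)"] by blast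
  define small where "small = {D \<in> R. obj_length C D < r}"
  have "small = (\<Union>s<r. L s)" unfolding small_def L_def by auto
  then have fin_small: "finite small" using r(2) by simp
  define \<tau> where "\<tau> X = {D \<in> small. maps_to X D}" for X
  have "\<tau> ` L r \<subseteq> Pow small" unfolding \<tau>_def by auto
  then have "finite (\<tau> ` L r)" using fin_small finite_subset by blast
  then obtain X0 where X0: "infinite {X \<in> L r. \<tau> X = \<tau> X0}"
    using pigeonhole_infinite[OF r(1)] by blast
  then obtain S :: "nat \<Rightarrow> _" where S: "inj S" "range S \<subseteq> {X \<in> L r. \<tau> X = \<tau> X0}"
    using infinite_countable_subset by blast
  have SR: "S k \<in> R" "obj_length C (S k) = r" "\<tau> (S k) = \<tau> X0" for k
    using S(2) unfolding L_def by auto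
  have br: "brick C (S k)" "S k \<in> Obj C" for k using SR(1) R(1) by auto
  have transfer: "maps_to (S j) D" if D: "brick C D" "obj_length C D < r" "maps_to (S i) D" for i j D
  proof -
    have "D \<in> Obj C" using D(1) by (simp add: brick_def)
    then obtain D' where D': "D' \<in> R" "(D, D') \<in> iso_rel C" using R(2)[of D] D(1) by auto
    then have "D' \<in> \<tau> (S i)"
      unfolding \<tau>_def small_def using D maps_to_iso[OF D'(2)] length_iso[OF D'(2)] by simp
    then have "D' \<in> \<tau> (S j)" using SR(3) by simp
    then show ?thesis unfolding \<tau>_def using maps_to_iso[OF D'(2)] by simp
  qed
  have quot: "maps_to (S j) Q"
    if e: "e \<in> Hom C (S i) Q" "is_epi C e" "\<not> is_mono C e" "\<not> is_zero_obj C Q" for i j e Q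
  proof -
    have Q: "Q \<in> Obj C" using e Hom_Obj by blast
    obtain D d m where D: "brick C D" "d \<in> Hom C Q D" "is_epi C d" "m \<in> Hom C D Q" "is_mono C m"
      using brick_quotient_subobject[OF Q e(4)] .
    have "obj_length C Q < r"
      using length_epi[OF e(1,2)] e(3) iso_mono SR(2) by (metis not_le)
    then have lD: "obj_length C D < r" using length_mono(1)[OF D(4,5)] by simp
    have "d \<noteq> Hzero C Q D" using epi_zero_cod[OF D(2,3)] D(1) brick_iff by blast
    then have "maps_to (S i) D" using maps_to_epi[OF _ e(1,2)] D(2) unfolding maps_to_def by blast
    then show ?thesis using transfer[OF D(1) lD] maps_to_mono D(4,5) by blast
  qed
  have orth: "\<not> maps_to (S i) (S j)" if "i \<noteq> j" for i j
  proof
    assume "maps_to (S i) (S j)"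
    then obtain f where f: "f \<in> Hom C (S i) (S j)" "f \<noteq> Hzero C (S i) (S j)" unfolding maps_to_def by blast
    obtain I e m where em: "e \<in> Hom C (S i) I" "m \<in> Hom C I (S j)" "is_epi C e" "is_mono C m"
      "f = m \<cdot> e" "\<not> is_zero_obj C I" using nonzero_image[OF f] by metis
    have me: "\<not> is_iso C m"
    proof
      assume m: "is_iso C m"
      then have "(I, S j) \<in> iso_rel C" using em(2) Hom_Obj unfolding iso_rel_def by blast
      then have "obj_length C I = r" using length_iso SR(2) by simp
      then have "is_iso C e" using length_epi(2)[OF em(1,3)] SR(2) by simp
      then have "is_iso C f" using iso_comp[OF _ m em(1,2)] em(5) by simp
      then have "(S i, S j) \<in> iso_rel C" using f(1) br(2) unfolding iso_rel_def by blast
      then have "S i = S j" using R(4) SR(1) by blast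
      then show False using \<open>i \<noteq> j\<close> injD[OF S(1)] by blast
    qed
    have oI: "I \<in> Obj C" using em Hom_Obj by blast
    obtain D d l where D: "brick C D" "d \<in> Hom C I D" "is_epi C d" "l \<in> Hom C D I" "is_mono C l"
      using brick_quotient_subobject[OF oI em(6)] .
    have "obj_length C I < r" using length_mono[OF em(2,4)] me SR(2) by (metis not_le)
    then have lD: "obj_length C D < r" using length_mono(1)[OF D(4,5)] by simp
    have "d \<noteq> Hzero C I D" using epi_zero_cod[OF D(2,3)] D(1) brick_iff by blast
    then have "maps_to (S i) D" using maps_to_epi[OF _ em(1,3)] D(2) unfolding maps_to_def by blast
    then have "maps_to (S j) D" using transfer[OF D(1) lD] by blast
    then obtain g where g: "g \<in> Hom C (S j) D" "g \<noteq> Hzero C (S j) D" unfolding maps_to_def by blast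
    note lm = Comp_closed[OF D(4) em(2)] mono_comp[OF D(5) em(4) D(4) em(2)]
    note lmg = Comp_closed[OF g(1) lm(1)]
    have "(m \<cdot> l) \<cdot> g \<noteq> Hzero C (S j) (S j)" using mono_zeroD[OF lm(2,1) g(1)] g(2) by blast
    then have "is_iso C ((m \<cdot> l) \<cdot> g)" using br lmg brick_iff by blast
    then have "is_mono C g" using mono_cancel[OF g(1) lm(1)] iso_mono by blast
    then have "r \<le> obj_length C D" using length_mono(1)[OF g(1)] SR(2) by simp
    then show False using lD by simp
  qed
  have "orthogonal_bricks C S"
    by unfold_locales (use br orth quot in blast)+
  then show ?thesis by blast
qed

end

theorem theorem1p2:
  fixes A :: "('o, 'm) preadd_cat"
  assumes "abelian_length_category A"
    and "finite_up_to_iso A (simple_obj A)"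
  shows "brick_finite A \<longleftrightarrow> (\<exists>N::nat. \<forall>B. brick A B \<longrightarrow> obj_length A B < N)"
proof
  interpret abelian_length_category A by fact
  show "\<exists>N::nat. \<forall>B. brick A B \<longrightarrow> obj_length A B < N" if "brick_finite A"
    using brick_finite_bounded that by blast
  assume "\<exists>N::nat. \<forall>B. brick A B \<longrightarrow> obj_length A B < N"
  then obtain N where N: "\<And>B. brick A B \<Longrightarrow> obj_length A B < N" by blast
  show "brick_finite A"
  proof (rule ccontr)
    assume "\<not> brick_finite A"
    then obtain S where "orthogonal_bricks A S" using infinitely_many_bricks_orthogonal N by blast
    then interpret orthogonal_bricks A S .
    obtain R where "finite R" "\<And>X. X \<in> Obj A \<Longrightarrow> simple_obj A X \<Longrightarrow> \<exists>Y\<in>R. (X, Y) \<in> iso_rel A"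
      using representatives[of "simple_obj A"] assms(2) by metis
    then obtain B where "brick A B" "N \<le> obj_length A B"
      using unbounded_brick_lengths[of R N] unfolding simple_obj_def by blast
    then show False using N by fastforce
  qed
qed

end
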